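(* Let $p$ be a real polynomial with degree $\deg p>2$. Let $T>0$, $(t_1,x_1),(t_2,x_2)\in\mathbb{R}\times\mathbb{T}$ and $v_1,v_2\in\mathbb{R}$, $v_1\ne v_2$. Then the following are equivalent: (i) The qualitative observability $$u(t_i+t,x_i-v_it)=0\ \ \forall i=1,2,\ t\in(0,T)\ \Longrightarrow\ u_0=0$$ holds for all solutions $u$ of $\partial_tu=iP(D)u$, $u(0,x)=u_0(x)\in L^2(\mathbb{T})$. (ii) The quantitative observability $$\int_{\mathbb{T}}|u_0(x)|^2\,dx\lesssim\int_0^T\sum_{i=1}^2|u(t_i+t,x_i-v_it)|^2\,dt$$ holds for all solutions $u$ of $\partial_tu=iP(D)u$, $u(0,x)=u_0(x)\in L^2(\mathbb{T})$. (iii) The graph $G(v_1,v_2)$ has no two-colored cycle.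
   Context: $\mathbb{T}=\mathbb{R}/2\pi\mathbb{Z}$. $P(D)$ is the Fourier multiplier on $\mathbb{T}$ with symbol $p$ restricted to $\mathbb{Z}$, i.e. $\widehat{P(D)u}(k)=p(k)\widehat u(k)$, $k\in\mathbb{Z}$. For $u_0=\sum_{k\in\mathbb{Z}}c_ke^{ikx}\in L^2(\mathbb{T})$, the solution of $\partial_tu=iP(D)u$, $u(0,\cdot)=u_0$, is $u(t,x)=\sum_{k\in\mathbb{Z}}c_ke^{ip(k)t}e^{ikx}$, and the restriction to a line is given by the series $u(t_0+t,x_0-vt)=\sum_{k\in\mathbb{Z}}c_ke^{i(p(k)t_0+kx_0)}e^{i\lambda_k(v)t}$, where $\lambda_k(v):=p(k)-kv$ for $v\in\mathbb{R}$, $k\in\mathbb{Z}$. Put $\Pi(v):=\{k\in\mathbb{Z}:\exists m\in\mathbb{Z},\ m\ne k,\ \lambda_k(v)=\lambda_m(v)\}$. For $v_1\ne v_2$, the edge-colored graph $G(v_1,v_2)$ has vertex set $\Pi(v_1)\cup\Pi(v_2)$; two distinct vertices $k_1,k_2$ are joined by a red edge if $\lambda_{k_1}(v_1)=\lambda_{k_2}(v_1)$ and by a blue edge if $\lambda_{k_1}(v_2)=\lambda_{k_2}(v_2)$ (both cannot happen simultaneously, so the graph is simple). A cycle is a (finite) simple graph whose vertices can be arranged in a cyclic sequence so that two vertices are adjacent if and only if they are consecutive; $G(v_1,v_2)$ has a cycle if it contains one as a subgraph. A cycle is two-colored if its edges contain both colors. $A\lesssim B$ means $A\le CB$ with a constant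 $C>0$ independent of the solution $u$ (it may depend on $p,v_i,T$ and other data). *)

theory Defs
  imports "HOL-Analysis.Analysis" "HOL-Computational_Algebra.Polynomial"
begin

section \<open>Square-integrable functions and Fourier coefficients\<close>

definition L2_on :: "real set \<Rightarrow> (real \<Rightarrow> complex) \<Rightarrow> bool" where
  "L2_on S f \<longleftrightarrow> f \<in> borel_measurable (lebesgue_on S) \<and>
     integrable (lebesgue_on S) (\<lambda>x. (cmod (f x))\<^sup>2)"

text \<open>Functions on the torus \<open>\<real>/2\<pi>\<int>\<close> are \<open>2\<pi>\<close>-periodic functions on the line, and
  integrals over the torus are integrals over \<open>[0, 2\<pi>]\<close>. A point of the torus is given by
  any real representative.\<close>

definition L2_torus :: "(real \<Rightarrow> complex) \<Rightarrow> bool" where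
  "L2_torus f \<longleftrightarrow> (\<forall>x. f (x + 2 * pi) = f x) \<and> L2_on {0..2 * pi} f"

definition fourier_coeff :: "(real \<Rightarrow> complex) \<Rightarrow> int \<Rightarrow> complex" where
  "fourier_coeff f k =
     (1 / (2 * pi)) *\<^sub>R (LINT x|lebesgue_on {0..2 * pi}. f x * cis (- (of_int k * x)))"


section \<open>Solutions and their restrictions to lines\<close>

text \<open>\<open>u t x\<close> solves \<open>\<partial>\<^sub>t u = i P(D) u\<close>, \<open>u(0) = u\<^sub>0\<close>. As \<open>P(D) u\<close> is in general only a
  distribution, the equation is read on the Fourier side, where \<open>P(D)\<close> multiplies the
  \<open>k\<close>-th Fourier coefficient by \<open>p(k)\<close>. The lemma \<open>fourier_coeff_solution\<close> recovers
  the usual series formula.\<close>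

definition is_solution :: "real poly \<Rightarrow> (real \<Rightarrow> complex) \<Rightarrow> (real \<Rightarrow> real \<Rightarrow> complex) \<Rightarrow> bool" where
  "is_solution p u0 u \<longleftrightarrow>
     L2_torus u0 \<and> (\<forall>t. L2_torus (u t)) \<and>
     (AE x in lebesgue_on {0..2 * pi}. u 0 x = u0 x) \<and>
     (\<forall>k t. ((\<lambda>s. fourier_coeff (u s) k) has_vector_derivative
        \<i> * (of_real (poly p (of_int k)) * fourier_coeff (u t) k)) (at t))"

definition fourier_partial_sum :: "nat \<Rightarrow> (real \<Rightarrow> complex) \<Rightarrow> real \<Rightarrow> complex" where
  "fourier_partial_sum N f x = (\<Sum>k\<in>{- int N..int N}. fourier_coeff f k * cis (of_int k * x))"

text \<open>A line is a null set, so the restriction \<open>t \<mapsto> u(t\<^sub>0 + t, x\<^sub>0 - v t)\<close>,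
  \<open>0 < t < T\<close>, cannot be read off from the values of \<open>u\<close>: it is the sum
  \<open>f\<close> in \<open>L\<^sup>2(0, T)\<close> of the restricted Fourier series, and is determined up to null sets.
  The lemma \<open>fourier_partial_sum_on_line\<close> gives the terms of that series.\<close>

definition is_line_restriction ::
  "(real \<Rightarrow> real \<Rightarrow> complex) \<Rightarrow> real \<Rightarrow> real \<Rightarrow> real \<Rightarrow> real \<Rightarrow> (real \<Rightarrow> complex) \<Rightarrow> bool" where
  "is_line_restriction u t0 x0 v T f \<longleftrightarrow>
     L2_on {0<..<T} f \<and>
     (\<lambda>N. LINT t|lebesgue_on {0<..<T}.
        (cmod (f t - fourier_partial_sum N (u (t0 + t)) (x0 - v * t)))\<^sup>2) \<longlonglongrightarrow> 0"


section \<open>Observability on two lines\<close>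

definition qualitative_observability ::
  "real poly \<Rightarrow> real \<Rightarrow> real \<Rightarrow> real \<Rightarrow> real \<Rightarrow> real \<Rightarrow> real \<Rightarrow> real \<Rightarrow> bool" where
  "qualitative_observability p T t1 x1 v1 t2 x2 v2 \<longleftrightarrow>
     (\<forall>u0 u f1 f2.
        is_solution p u0 u \<longrightarrow>
        is_line_restriction u t1 x1 v1 T f1 \<longrightarrow> is_line_restriction u t2 x2 v2 T f2 \<longrightarrow>
        (AE t in lebesgue_on {0<..<T}. f1 t = 0) \<longrightarrow> (AE t in lebesgue_on {0<..<T}. f2 t = 0) \<longrightarrow>
        (AE x in lebesgue_on {0..2 * pi}. u0 x = 0))"

definition quantitative_observability ::
  "real poly \<Rightarrow> real \<Rightarrow> real \<Rightarrow> real \<Rightarrow> real \<Rightarrow> real \<Rightarrow> real \<Rightarrow> real \<Rightarrow> bool" where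
  "quantitative_observability p T t1 x1 v1 t2 x2 v2 \<longleftrightarrow>
     (\<exists>C>0. \<forall>u0 u f1 f2.
        is_solution p u0 u \<longrightarrow>
        is_line_restriction u t1 x1 v1 T f1 \<longrightarrow> is_line_restriction u t2 x2 v2 T f2 \<longrightarrow>
        (LINT x|lebesgue_on {0..2 * pi}. (cmod (u0 x))\<^sup>2) \<le>
          C * (LINT t|lebesgue_on {0<..<T}. (cmod (f1 t))\<^sup>2 + (cmod (f2 t))\<^sup>2))"


section \<open>The edge-colored graph\<close>

definition lam :: "real poly \<Rightarrow> real \<Rightarrow> int \<Rightarrow> real" where
  "lam p v k = poly p (of_int k) - of_int k * v"

definition Pi_set :: "real poly \<Rightarrow> real \<Rightarrow> int set" where
  "Pi_set p v = {k. \<exists>m. m \<noteq> k \<and> lam p v k = lam p v m}"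

definition graph_verts :: "real poly \<Rightarrow> real \<Rightarrow> real \<Rightarrow> int set" where
  "graph_verts p v1 v2 = Pi_set p v1 \<union> Pi_set p v2"

definition red_edges :: "real poly \<Rightarrow> real \<Rightarrow> real \<Rightarrow> int set set" where
  "red_edges p v1 v2 = {{k1, k2} | k1 k2. k1 \<in> graph_verts p v1 v2 \<and> k2 \<in> graph_verts p v1 v2 \<and>
     k1 \<noteq> k2 \<and> lam p v1 k1 = lam p v1 k2}"

definition blue_edges :: "real poly \<Rightarrow> real \<Rightarrow> real \<Rightarrow> int set set" where
  "blue_edges p v1 v2 = {{k1, k2} | k1 k2. k1 \<in> graph_verts p v1 v2 \<and> k2 \<in> graph_verts p v1 v2 \<and>
     k1 \<noteq> k2 \<and> lam p v2 k1 = lam p v2 k2}"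

text \<open>The simple graph with vertex set \<open>V\<close> and edge set \<open>E\<close> (of two-element sets) is a cycle.
  As usual for simple graphs, a cycle has at least three vertices.\<close>

definition is_cycle_graph :: "'a set \<Rightarrow> 'a set set \<Rightarrow> bool" where
  "is_cycle_graph V E \<longleftrightarrow>
     (\<exists>xs. distinct xs \<and> length xs \<ge> 3 \<and> V = set xs \<and>
        E = {{xs ! i, xs ! (Suc i mod length xs)} | i. i < length xs})"

definition has_two_colored_cycle :: "real poly \<Rightarrow> real \<Rightarrow> real \<Rightarrow> bool" where
  "has_two_colored_cycle p v1 v2 \<longleftrightarrow>
     (\<exists>V E. is_cycle_graph V E \<and> V \<subseteq> graph_verts p v1 v2 \<and>
        E \<subseteq> red_edges p v1 v2 \<union> blue_edges p v1 v2 \<and>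
        E \<inter> red_edges p v1 v2 \<noteq> {} \<and> E \<inter> blue_edges p v1 v2 \<noteq> {})"


section \<open>The series formulas\<close>

lemma fourier_coeff_cong_AE:
  assumes "L2_torus f" "L2_torus g" "AE x in lebesgue_on {0..2 * pi}. f x = g x"
  shows "fourier_coeff f k = fourier_coeff g k"
proof -
  have c: "(\<lambda>x. cis (- (of_int k * x))) \<in> borel_measurable (lebesgue_on {0..2 * pi})"
    by (intro continuous_imp_measurable_on_sets_lebesgue continuous_intros) auto
  have "(LINT x|lebesgue_on {0..2 * pi}. f x * cis (- (of_int k * x))) =
        (LINT x|lebesgue_on {0..2 * pi}. g x * cis (- (of_int k * x)))"
    using assms c
    by (intro integral_cong_AE borel_measurable_times) (auto simp: L2_torus_def L2_on_def)
  then show ?thesis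
    by (simp add: fourier_coeff_def)
qed

lemma fourier_coeff_solution:
  assumes "is_solution p u0 u"
  shows "fourier_coeff (u t) k = fourier_coeff u0 k * cis (poly p (of_int k) * t)"
proof -
  define a where "a = poly p (of_int k)"
  define h where "h = (\<lambda>s. fourier_coeff (u s) k * exp (- (\<i> * of_real (a * s))))"
  have d: "((\<lambda>s. fourier_coeff (u s) k) has_vector_derivative
      \<i> * (of_real a * fourier_coeff (u s) k)) (at s)" for s
    using assms by (simp add: is_solution_def a_def)
  have e: "((\<lambda>s. exp (- (\<i> * of_real (a * s)))) has_vector_derivative
      - (\<i> * of_real a) * exp (- (\<i> * of_real (a * s)))) (at s)" for s
  proof -
    have "((\<lambda>z. exp (- (\<i> * (of_real a * z)))) has_field_derivative
        - (\<i> * of_real a) * exp (- (\<i> * of_real (a * s)))) (at (of_real s))"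
      by (auto intro!: derivative_eq_intros)
    from has_vector_derivative_real_field[OF this] show ?thesis
      by simp
  qed
  have "(h has_vector_derivative 0) (at s within UNIV)" for s
    unfolding h_def
    by (rule has_vector_derivative_eq_rhs[OF has_vector_derivative_mult[OF d e]])
       (simp add: algebra_simps)
  then obtain c where "h s = c" for s
    using has_vector_derivative_zero_constant[of UNIV h] by auto
  then have "h t = h 0"
    by simp
  moreover have "fourier_coeff (u 0) k = fourier_coeff u0 k"
    using assms by (intro fourier_coeff_cong_AE) (auto simp: is_solution_def)
  ultimately have "fourier_coeff (u t) k * exp (- (\<i> * of_real (a * t))) = fourier_coeff u0 k"
    by (simp add: h_def)
  then show ?thesis
    by (simp add: cis_conv_exp exp_minus a_def field_simps)
qed

lemma fourier_partial_sum_on_line: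
  assumes "is_solution p u0 u"
  shows "fourier_partial_sum N (u (t0 + t)) (x0 - v * t) =
    (\<Sum>k\<in>{- int N..int N}. fourier_coeff u0 k * cis (poly p (of_int k) * t0 + of_int k * x0) *
       cis (lam p v k * t))"
  unfolding fourier_partial_sum_def
  by (intro sum.cong)
     (simp_all add: fourier_coeff_solution[OF assms] lam_def cis_mult mult.assoc algebra_simps)

end

(* On the line of speed v_i the solution restricts to an exponential sum with frequencies
   lambda_k(v_i). If lambda_k and lambda_m are at bounded distance for k /= m and k is large,
   then k and m are mirror images under a reflection whose centre depends only on the two leading
   coefficients of p, and along such pairs lambda_k - lambda_m is an odd polynomial, zero or
   unbounded. Hence the gaps tend to infinity, and an Ingham inequality on every interval bounds
   the sums S_i(mu) of the coefficients over the classes {k. lambda_k(v_i) = mu} by the L^2 norm on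
   the line. The centre being the same for v_1 and v_2, only finitely many k share a class with other
   indices for both speeds.

   Translating time and space to the point where the two lines meet removes all phases, so what
   remains is whether the class sums S_1, S_2 determine the coefficients. Without two-colored
   cycles, every nonempty finite set of indices contains one that is alone in its red or in its blue class;
   peeling off such indices bounds the finitely many remaining coefficients. Conversely, summing
   the differences e_x - e_y over the red edges (x, y) of an oriented two-colored cycle gives a
   nonzero trigonometric polynomial that vanishes on both lines. *)
theory Submission
  imports Defs
begin

text \<open>The hypothesis on the degree enters through the centre of reflection: subtracting k v
  changes only the coefficient of degree 1, which for degree above 2 is neither of the two leading
  ones. In degree 2 the centre would move with v, and infinitely many indices could collide for both
  speeds.

  The obstacle in the Ingham step is that a direct argument with gap gamma needs an interval of
  length of order 1/gamma, while T is arbitrary. The finitely many frequencies within 28/T of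
  another one are therefore set aside, the others are handled on half of the interval, and the
  exceptional ones are put back one at a time, each at the price of an arbitrarily small piece of
  time. Exact coincidences cause no trouble because the inequality is applied to the set of values
  of \<open>lam\<close>, not to the indices.

  All estimates concern finite sums, with constants independent of the number of terms; the limit is
  taken once, at the end. Bounding the norm of the initial datum by its coefficients is the half of
  Parseval's identity that needs completeness of the exponentials.\<close>

section \<open>Near-collisions of frequencies\<close>

lemma power_diff_ge:
  fixes s t :: real
  assumes "0 \<le> s" "s \<le> t" "0 < n"
  shows "(t - s) * t ^ (n - 1) \<le> t ^ n - s ^ n"
proof -
  have "s * s ^ (n - 1) \<le> s * t ^ (n - 1)"
    using assms by (intro mult_left_mono power_mono) auto
  moreover have "t ^ n = t * t ^ (n - 1)" "s ^ n = s * s ^ (n - 1)"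
    using assms(3) by (metis power_eq_if less_numeral_extra(3))+
  ultimately show ?thesis
    by (simp add: algebra_simps)
qed

lemma poly_abs_bound:
  fixes r :: "real poly"
  assumes "degree r \<le> n"
  obtains K where "0 \<le> K" "\<And>x y. 1 \<le> y \<Longrightarrow> \<bar>x\<bar> \<le> L * y \<Longrightarrow> \<bar>poly r x\<bar> \<le> K * y ^ n"
proof
  define M where "M = max 1 L"
  let ?K = "(\<Sum>i\<le>degree r. \<bar>coeff r i\<bar>) * M ^ n"
  show "0 \<le> ?K"
    by (auto simp: M_def intro!: mult_nonneg_nonneg sum_nonneg)
  fix x y :: real assume y: "1 \<le> y" and x: "\<bar>x\<bar> \<le> L * y"
  have xM: "\<bar>x\<bar> \<le> M * y"
    using x y by (auto simp: M_def intro: order_trans[OF x] mult_right_mono)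
  have My: "1 \<le> M * y"
    using mult_mono[of 1 M 1 y] y by (simp add: M_def)
  have "\<bar>poly r x\<bar> \<le> (\<Sum>i\<le>degree r. \<bar>coeff r i * x ^ i\<bar>)"
    unfolding poly_altdef by (rule sum_abs)
  also have "\<dots> \<le> (\<Sum>i\<le>degree r. \<bar>coeff r i\<bar> * (M * y) ^ n)"
  proof (rule sum_mono)
    fix i assume i: "i \<in> {..degree r}"
    have "\<bar>x\<bar> ^ i \<le> (M * y) ^ i"
      using xM by (intro power_mono) auto
    also have "\<dots> \<le> (M * y) ^ n"
      using i assms My by (intro power_increasing) auto
    finally show "\<bar>coeff r i * x ^ i\<bar> \<le> \<bar>coeff r i\<bar> * (M * y) ^ n"
      by (auto simp: abs_mult power_abs intro!: mult_left_mono)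
  qed
  finally show "\<bar>poly r x\<bar> \<le> ?K * y ^ n"
    by (simp add: sum_distrib_right power_mult_distrib mult.assoc)
qed

text \<open>Integers are discrete; this upgrades "k + m is close to 2c" to the exact reflection k +
  m = 2c, even when 2c is not an integer.\<close>

lemma isolated_zero_int_shift:
  fixes c :: real
  obtains \<delta> where "0 < \<delta>"
    "\<And>j::int. \<bar>real_of_int j - c\<bar> < \<delta> \<Longrightarrow> real_of_int j = c"
proof (cases "c \<in> \<int>")
  case True
  then obtain i where "c = of_int i" by (auto elim: Ints_cases)
  moreover have "j = i" if "\<bar>real_of_int j - of_int i\<bar> < 1" for j
    using that by linarith
  ultimately have "real_of_int j = c" if "\<bar>real_of_int j - c\<bar> < 1" for j
    using that by simp
  then show ?thesis using that[of 1] by auto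
next
  case False
  define \<delta> where "\<delta> = min (frac c) (1 - frac c)"
  have "0 < \<delta>" using False frac_lt_1[of c] frac_gt_0_iff[of c] by (auto simp: \<delta>_def)
  moreover have "\<not> \<bar>real_of_int j - c\<bar> < \<delta>" for j
  proof (cases "j \<le> \<lfloor>c\<rfloor>")
    case True
    then have "real_of_int j \<le> of_int \<lfloor>c\<rfloor>" by simp
    then show ?thesis by (auto simp: \<delta>_def frac_def)
  next
    case False
    then have "real_of_int j \<ge> of_int \<lfloor>c\<rfloor> + 1" by linarith
    then show ?thesis by (auto simp: \<delta>_def frac_def)
  qed
  ultimately show ?thesis using that[of \<delta>] by auto
qed

text \<open>Completing the n-th power around \<open>c\<close> leaves a remainder \<open>r\<close> of
  degree at most n - 2. With y = |k - c| >= z = |m - c|, closeness of the two values then forces y -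
  z = O(1/y). Distinct integers cannot be that close on the same side of \<open>c\<close>, so they
  lie on opposite sides, and k + m - 2c, which is y - z up to sign, is too small to be
  nonzero.\<close>

lemma near_collision_reflected:
  fixes q :: "real poly" and R :: real
  assumes d: "2 \<le> degree q"
  defines "c \<equiv> - coeff q (degree q - 1) / (real (degree q) * lead_coeff q)"
  obtains Y where "\<And>k m :: int. \<lbrakk>\<bar>poly q k - poly q m\<bar> \<le> R; k \<noteq> m; Y \<le> \<bar>real_of_int k\<bar>\<rbrakk> \<Longrightarrow>
    real_of_int (k + m) = 2 * c"
proof -
  define n where "n = degree q"
  define a where "a = lead_coeff q"
  have n: "2 \<le> n" using d by (simp add: n_def)
  have a: "a \<noteq> 0" using d by (auto simp: a_def)
  define r where "r = q - smult a ([:- c, 1:] ^ n)"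
  have deg_r: "degree r \<le> n - 2"
  proof (rule degree_le, intro allI impI)
    fix i assume i: "n - 2 < i"
    have dq: "degree ([:- c, 1:] ^ n) = n"
      by (rule degree_linear_power)
    consider "i = n" | "i = n - 1" | "n < i"
      using i n by linarith
    then show "coeff r i = 0"
    proof cases
      case 1
      then show ?thesis
        by (simp add: r_def coeff_linear_poly_power a_def n_def)
    next
      case 2
      have "n choose (n - 1) = n"
        using binomial_symmetric[of 1 n] n by simp
      then have "coeff ([:- c, 1:] ^ n) (n - 1) = - (real n * c)"
        using n by (subst coeff_linear_poly_power) auto
      then show ?thesis
        using 2 a n by (simp add: r_def c_def a_def n_def)
    next
      case 3
      then show ?thesis
        using dq by (simp add: r_def coeff_eq_0 n_def)
    qed
  qed
  obtain K where K: "0 \<le> K" "\<And>x y. 1 \<le> y \<Longrightarrow> \<bar>x\<bar> \<le> (1 + \<bar>c\<bar>) * y \<Longrightarrow> \<bar>poly r x\<bar> \<le> K * y ^ (n - 2)"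
    using poly_abs_bound[OF deg_r] by blast
  obtain \<delta>' where \<delta>': "0 < \<delta>'" "\<And>j::int. \<bar>real_of_int j - 2 * c\<bar> < \<delta>' \<Longrightarrow> real_of_int j = 2 * c"
    using isolated_zero_int_shift by blast
  \<comment> \<open>The bound 1 rules out that k and m lie on the same side of \<open>c\<close>; the
    bound \<open>\<delta>'\<close> makes the reflection exact.\<close>
  define \<delta> where "\<delta> = min 1 \<delta>'"
  have \<delta>: "0 < \<delta>" using \<delta>' by (simp add: \<delta>_def)
  \<comment> \<open>From \<open>Y0\<close> on, (|R| + 2K) / (|a| y), which bounds y - z, is below
    \<open>\<delta>\<close>.\<close>
  define Y0 where "Y0 = 1 + (\<bar>R\<bar> + 2 * K) / (\<bar>a\<bar> * \<delta>)"
  have Y0: "1 \<le> Y0" using K \<delta> by (simp add: Y0_def)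
  have key: "real_of_int (k + m) = 2 * c"
    if le: "\<bar>poly q k - poly q m\<bar> \<le> R" and km: "k \<noteq> m" and y: "Y0 \<le> \<bar>k - c\<bar>" and zy: "\<bar>m - c\<bar> \<le> \<bar>k - c\<bar>"
    for k m :: int
  proof -
    define y where "y = \<bar>k - c\<bar>"
    define z where "z = \<bar>m - c\<bar>"
    have y1: "1 \<le> y" and yz: "z \<le> y" "0 \<le> z" using y Y0 zy by (auto simp: y_def z_def)
    have yy: "y ^ (n - 1) = y * y ^ (n - 2)"
      using n by (metis Suc_diff_Suc Suc_1 Suc_le_lessD numeral_2_eq_2 power_Suc)
    have lin: "\<bar>real_of_int x\<bar> \<le> (1 + \<bar>c\<bar>) * y" if "\<bar>x - c\<bar> \<le> y" for x
    proof -
      have "\<bar>real_of_int x\<bar> \<le> y + \<bar>c\<bar> * 1" using that by simp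
      also have "\<dots> \<le> y + \<bar>c\<bar> * y" using y1 by (intro add_left_mono mult_left_mono) auto
      finally show ?thesis by (simp add: algebra_simps)
    qed
    have rk: "\<bar>poly r k\<bar> \<le> K * y ^ (n - 2)" and rm: "\<bar>poly r m\<bar> \<le> K * y ^ (n - 2)"
      using y1 yz by (intro K(2) lin; simp add: y_def z_def)+
    have q: "poly q x = a * (x - c) ^ n + poly r x" for x
      by (simp add: r_def poly_power algebra_simps)
    have "\<bar>a\<bar> * ((y - z) * y ^ (n - 1)) \<le> \<bar>a\<bar> * (y ^ n - z ^ n)"
      using yz n by (intro mult_left_mono power_diff_ge) auto
    also have "\<dots> \<le> \<bar>a\<bar> * \<bar>(k - c) ^ n - (m - c) ^ n\<bar>"
      by (intro mult_left_mono) (auto simp: y_def z_def power_abs[symmetric])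
    also have "\<dots> = \<bar>(poly q k - poly q m) - poly r k + poly r m\<bar>"
      unfolding abs_mult[symmetric] q by (simp add: algebra_simps)
    also have "\<dots> \<le> \<bar>R\<bar> * 1 + 2 * (K * y ^ (n - 2))"
      using le rk rm by linarith
    also have "\<dots> \<le> \<bar>R\<bar> * y ^ (n - 2) + 2 * (K * y ^ (n - 2))"
      using y1 by (intro add_right_mono mult_left_mono) (auto intro: one_le_power)
    finally have "y ^ (n - 2) * (\<bar>a\<bar> * (y - z) * y) \<le> y ^ (n - 2) * (\<bar>R\<bar> + 2 * K)"
      unfolding yy by (simp add: algebra_simps)
    then have le2: "\<bar>a\<bar> * (y - z) * y \<le> \<bar>R\<bar> + 2 * K"
      using y1 by (subst (asm) mult_le_cancel_left_pos) auto
    have "(\<bar>R\<bar> + 2 * K) / (\<bar>a\<bar> * \<delta>) < y"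
      using y by (simp add: Y0_def y_def)
    then have "\<bar>R\<bar> + 2 * K < \<bar>a\<bar> * \<delta> * y"
      using a \<delta> by (simp add: field_simps)
    with le2 have "\<bar>a\<bar> * y * (y - z) < \<bar>a\<bar> * y * \<delta>"
      by (simp add: algebra_simps)
    then have "y - z < \<delta>"
      using a y1 by (subst (asm) mult_less_cancel_left_pos) auto
    then have "\<bar>y - z\<bar> < 1" "\<bar>y - z\<bar> < \<delta>'"
      using yz by (auto simp: \<delta>_def)
    moreover have "\<bar>real_of_int k - real_of_int m\<bar> \<ge> 1"
      using km by linarith
    ultimately have "\<bar>real_of_int (k + m) - 2 * c\<bar> < \<delta>'"
      unfolding y_def z_def abs_if by (auto split: if_splits)
    then show ?thesis by (rule \<delta>')
  qed
  \<comment> \<open>\<open>key\<close> wants the larger distance from \<open>c\<close> at k. If m is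
    farther away, the roles are exchanged; the added |c| guarantees that k, and hence m, has
    distance at least \<open>Y0\<close>.\<close>
  have "real_of_int (k + m) = 2 * c"
    if le: "\<bar>poly q k - poly q m\<bar> \<le> R" and km: "k \<noteq> m" and y: "Y0 + \<bar>c\<bar> \<le> \<bar>real_of_int k\<bar>" for k m
  proof (cases "\<bar>m - c\<bar> \<le> \<bar>k - c\<bar>")
    case True
    with that show ?thesis by (intro key) auto
  next
    case False
    then have "real_of_int (m + k) = 2 * c"
      using that by (intro key) (auto simp: abs_minus_commute)
    then show ?thesis by (simp add: add.commute)
  qed
  then show ?thesis using that by blast
qed

text \<open>The difference is a polynomial in y that vanishes at 0, so it is nonconstant as soon as
  it is nonzero somewhere, and then tends to infinity in modulus.\<close>

lemma odd_part_proper: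
  fixes q :: "real poly" and c R :: real
  assumes "poly q (c + y0) \<noteq> poly q (c - y0)"
  obtains Y where "\<And>y. Y \<le> \<bar>y\<bar> \<Longrightarrow> R < \<bar>poly q (c + y) - poly q (c - y)\<bar>"
proof -
  define h where "h = pcompose q [:c, 1:] - pcompose q [:c, -1:]"
  have h: "poly h y = poly q (c + y) - poly q (c - y)" for y
    by (simp add: h_def poly_pcompose)
  have "0 < degree h"
  proof (rule ccontr)
    assume "\<not> 0 < degree h"
    then obtain a where "h = [:a:]" by (auto elim: degree_eq_zeroE)
    with h[of 0] h[of y0] assms show False by simp
  qed
  then have "filterlim (poly h) at_infinity at_infinity"
    by (intro filterlim_poly_at_infinity) (auto simp: filterlim_ident)
  then have "\<forall>\<^sub>F y in at_infinity. R + 1 \<le> norm (poly h y)"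
    by (auto simp: filterlim_at_infinity_conv_norm_at_top filterlim_at_top)
  then show ?thesis
    using that by (fastforce simp: eventually_at_infinity h)
qed

section \<open>Collisions among the frequencies \<open>lam\<close>\<close>

lemma lam_eq_poly: "lam p v k = poly (p - [:0, v:]) (of_int k)"
  by (simp add: lam_def mult.commute)

lemma finite_bounded_ints: "finite {k::int. \<bar>real_of_int k\<bar> < Y}"
proof (rule finite_subset)
  show "{k::int. \<bar>real_of_int k\<bar> < Y} \<subseteq> {- \<lceil>Y\<rceil>..\<lceil>Y\<rceil>}"
    by (auto simp: abs_less_iff) linarith+
qed simp

text \<open>The centre \<open>c\<close> depends only on the two leading coefficients, hence not on \<open>v\<close>.\<close>

lemma lam_near_collision_reflected:
  assumes d: "2 < degree p"
  obtains c where "\<And>v R. \<exists>Y. \<forall>k m. \<bar>lam p v k - lam p v m\<bar> \<le> R \<longrightarrow> k \<noteq> m \<longrightarrow>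
    Y \<le> \<bar>real_of_int k\<bar> \<longrightarrow> real_of_int (k + m) = 2 * c"
proof -
  define c where "c = - coeff p (degree p - 1) / (real (degree p) * lead_coeff p)"
  have "\<exists>Y. \<forall>k m. \<bar>lam p v k - lam p v m\<bar> \<le> R \<longrightarrow> k \<noteq> m \<longrightarrow>
    Y \<le> \<bar>real_of_int k\<bar> \<longrightarrow> real_of_int (k + m) = 2 * c" for v R
  proof -
    define q where "q = p - [:0, v:]"
    have "degree [:0, v:] < degree p"
      using d by (simp add: degree_pCons_eq_if)
    then have deg: "degree q = degree p"
      unfolding q_def diff_conv_add_uminus by (subst degree_add_eq_left) auto
    \<comment> \<open>Applied to degree p and degree p - 1, both at least 2; this is where degree p
      > 2 is needed.\<close>
    have "coeff [:0, v:] i = 0" if "2 \<le> i" for i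
      using that by (intro coeff_eq_0) (simp add: degree_pCons_eq_if)
    then have "coeff q (degree q) = coeff p (degree p)" "coeff q (degree q - 1) = coeff p (degree p - 1)"
      unfolding deg using d by (simp_all add: q_def)
    then have c: "c = - coeff q (degree q - 1) / (real (degree q) * lead_coeff q)"
      by (simp add: c_def deg)
    have "2 \<le> degree q" using d deg by simp
    from near_collision_reflected[OF this, of R, folded c] show ?thesis
      unfolding lam_eq_poly q_def[symmetric] by metis
  qed
  then show ?thesis using that by blast
qed

text \<open>A near-collision of a large k can only be with m = 2c - k, and then the gap is the odd
  part of the polynomial at y = k - c. If that odd part is identically zero, the values coincide and
  do not count; otherwise gaps of size at most R occur only for bounded y.\<close>

lemma finite_lam_near:
  assumes d: "2 < degree p"
  shows "finite {k. \<exists>m. lam p v k \<noteq> lam p v m \<and> \<bar>lam p v k - lam p v m\<bar> \<le> R}" (is "finite ?S")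
proof -
  obtain c where "\<And>v R. \<exists>Y. \<forall>k m. \<bar>lam p v k - lam p v m\<bar> \<le> R \<longrightarrow> k \<noteq> m \<longrightarrow>
    Y \<le> \<bar>real_of_int k\<bar> \<longrightarrow> real_of_int (k + m) = 2 * c"
    using lam_near_collision_reflected[OF d] by blast
  then obtain Y where Y: "\<And>k m. \<bar>lam p v k - lam p v m\<bar> \<le> R \<Longrightarrow> k \<noteq> m \<Longrightarrow>
    Y \<le> \<bar>real_of_int k\<bar> \<Longrightarrow> real_of_int (k + m) = 2 * c"
    by metis
  define q where "q = p - [:0, v:]"
  obtain Y' where Y': "\<And>y. poly q (c + y) \<noteq> poly q (c - y) \<Longrightarrow>
      \<bar>poly q (c + y) - poly q (c - y)\<bar> \<le> R \<Longrightarrow> \<bar>y\<bar> < Y'"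
  proof (cases "\<exists>y0. poly q (c + y0) \<noteq> poly q (c - y0)")
    case True
    then obtain y0 where "poly q (c + y0) \<noteq> poly q (c - y0)" ..
    from odd_part_proper[OF this, of R] that show ?thesis by (metis not_le)
  \<comment> \<open>If the odd part vanishes identically, the first premise is never met and any
    \<open>Y'\<close> serves.\<close>
  qed blast
  have "\<bar>real_of_int k\<bar> < max Y (Y' + \<bar>c\<bar>)" if k: "k \<in> ?S" for k
  proof (cases "\<bar>real_of_int k\<bar> < Y")
    case False
    obtain m where m: "lam p v k \<noteq> lam p v m" "\<bar>lam p v k - lam p v m\<bar> \<le> R"
      using k by auto
    have "real_of_int (k + m) = 2 * c"
      using m False by (intro Y) auto
    then have "real_of_int m = c - (k - c)" by simp
    then have "\<bar>k - c\<bar> < Y'"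
      using m by (intro Y') (auto simp: lam_eq_poly q_def[symmetric])
    then show ?thesis by linarith
  qed auto
  then show ?thesis
    by (intro finite_subset[OF _ finite_bounded_ints]) blast
qed

text \<open>No edge can be both red and blue: subtracting the two equations leaves (v1 - v2)(k - m)
  = 0.\<close>

lemma lam_eq_both_imp_eq:
  assumes "v1 \<noteq> v2" "lam p v1 k = lam p v1 m" "lam p v2 k = lam p v2 m"
  shows "k = m"
proof -
  have "(v1 - v2) * (real_of_int k - real_of_int m) = 0"
    using assms(2,3) by (simp add: lam_def algebra_simps)
  then show ?thesis using assms(1) by simp
qed

text \<open>A large k in both sets has a partner for each speed, and both partners equal 2c - k.
  They coincide, so one pair of distinct indices would collide for both speeds.\<close>

lemma finite_Pi_set_Int:
  assumes d: "2 < degree p" and "v1 \<noteq> v2"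
  shows "finite (Pi_set p v1 \<inter> Pi_set p v2)"
proof -
  obtain c where "\<And>v R. \<exists>Y. \<forall>k m. \<bar>lam p v k - lam p v m\<bar> \<le> R \<longrightarrow> k \<noteq> m \<longrightarrow>
    Y \<le> \<bar>real_of_int k\<bar> \<longrightarrow> real_of_int (k + m) = 2 * c"
    using lam_near_collision_reflected[OF d] by blast
  then have "\<exists>Y. \<forall>v k m. \<bar>lam p v k - lam p v m\<bar> \<le> 0 \<longrightarrow> k \<noteq> m \<longrightarrow>
    Y v \<le> \<bar>real_of_int k\<bar> \<longrightarrow> real_of_int (k + m) = 2 * c"
    by (intro choice) blast
  then obtain Y where Y: "\<And>v k m. \<bar>lam p v k - lam p v m\<bar> \<le> 0 \<Longrightarrow> k \<noteq> m \<Longrightarrow>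
    Y v \<le> \<bar>real_of_int k\<bar> \<Longrightarrow> real_of_int (k + m) = 2 * c"
    by blast
  have "\<bar>real_of_int k\<bar> < max (Y v1) (Y v2)" if k: "k \<in> Pi_set p v1 \<inter> Pi_set p v2" for k
  proof (rule ccontr)
    assume "\<not> ?thesis"
    then have ge: "Y v1 \<le> \<bar>real_of_int k\<bar>" "Y v2 \<le> \<bar>real_of_int k\<bar>" by auto
    obtain m where m: "m \<noteq> k" "lam p v1 k = lam p v1 m" using k by (auto simp: Pi_set_def)
    obtain n where n: "n \<noteq> k" "lam p v2 k = lam p v2 n" using k by (auto simp: Pi_set_def)
    have "real_of_int (k + m) = 2 * c" "real_of_int (k + n) = 2 * c"
      using Y[of v1 k m] Y[of v2 k n] m n ge by auto
    then have "real_of_int m = real_of_int n" by simp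
    then have "m = n" by simp
    then show False using lam_eq_both_imp_eq[OF assms(2)] m n by metis
  qed
  then show ?thesis
    by (intro finite_subset[OF _ finite_bounded_ints]) blast
qed

lemma finite_lam_fiber:
  assumes d: "2 < degree p"
  shows "finite {m. lam p v m = \<mu>}"
proof -
  define q where "q = p - [:\<mu>, v:]"
  have "degree [:\<mu>, v:] < degree p"
    using d by (simp add: degree_pCons_eq_if)
  then have "q \<noteq> 0" using d by (auto simp: q_def)
  then have "finite {x. poly q x = 0}" by (rule poly_roots_finite)
  then have "finite (real_of_int -` {x. poly q x = 0})"
    by (intro finite_vimageI) (auto simp: inj_on_def)
  moreover have "{m. lam p v m = \<mu>} \<subseteq> real_of_int -` {x. poly q x = 0}"
    by (auto simp: q_def lam_def algebra_simps)
  ultimately show ?thesis by (rule rev_finite_subset)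
qed

section \<open>Two-colored cycles and class sums\<close>

text \<open>Walk inside J, leaving along \<open>R\<close> and \<open>B\<close> alternately;
  finiteness forces a return. A shortest return has length at least 3: length 1 would be a standing
  step, and length 2 would be one edge with both colors. Among its first two edges both colors
  occur; at the closing point the alternation may break, which does no harm.\<close>

lemma alternating_cycle:
  fixes R B :: "'a \<Rightarrow> 'a \<Rightarrow> bool"
  assumes J: "finite J" "J \<noteq> {}"
    and R: "\<And>k. k \<in> J \<Longrightarrow> \<exists>m\<in>J. m \<noteq> k \<and> R k m"
    and B: "\<And>k. k \<in> J \<Longrightarrow> \<exists>m\<in>J. m \<noteq> k \<and> B k m"
    and sym: "\<And>k m. R k m \<Longrightarrow> R m k" "\<And>k m. B k m \<Longrightarrow> B m k"
    and RB: "\<And>k m. R k m \<Longrightarrow> B k m \<Longrightarrow> k = m"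
  obtains xs where "distinct xs" "3 \<le> length xs" "set xs \<subseteq> J"
    "\<And>i. i < length xs \<Longrightarrow> R (xs ! i) (xs ! (Suc i mod length xs)) \<or> B (xs ! i) (xs ! (Suc i mod length xs))"
    "\<exists>i<length xs. R (xs ! i) (xs ! (Suc i mod length xs))"
    "\<exists>i<length xs. B (xs ! i) (xs ! (Suc i mod length xs))"
proof -
  define C where "C n = (if even n then R else B)" for n :: nat
  have "\<exists>m\<in>J. m \<noteq> k \<and> C n k m" if "k \<in> J" for k n
    using R B that by (auto simp: C_def)
  then have "\<exists>f. \<forall>n. f n \<in> J \<and> (f (Suc n) \<noteq> f n \<and> C n (f n) (f (Suc n)))"
    using J by (intro dependent_nat_choice) auto
  then obtain f where f: "\<And>n. f n \<in> J" "\<And>n. f (Suc n) \<noteq> f n" "\<And>n. C n (f n) (f (Suc n))"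
    by blast
  have "\<not> inj_on f UNIV"
    using J f(1) finite_imageD[of f UNIV] finite_subset[of "range f" J] by auto
  then have ex: "\<exists>l. 0 < l \<and> (\<exists>i. f i = f (i + l))"
    unfolding inj_on_def by (metis UNIV_I less_imp_add_positive linorder_neqE_nat)
  \<comment> \<open>The minimum is over all starting points, so a repetition inside the chosen
    segment would be a shorter return. This makes the segment distinct.\<close>
  define l where "l = (LEAST l. 0 < l \<and> (\<exists>i. f i = f (i + l)))"
  have l: "0 < l" "\<exists>i. f i = f (i + l)"
    using LeastI_ex[OF ex] by (auto simp: l_def)
  have least: "f i \<noteq> f (i + l')" if "0 < l'" "l' < l" for i l'
    using not_less_Least[OF that(2)[unfolded l_def]] that(1) by auto
  obtain i where i: "f i = f (i + l)" using l by auto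
  have l3: "3 \<le> l"
  proof (rule ccontr)
    assume "\<not> 3 \<le> l"
    then consider "l = 1" | "l = 2" using l by linarith
    then show False
    proof cases
      case 2
      have "C i (f i) (f (Suc i))" "C (Suc i) (f (Suc i)) (f i)"
        using f(3)[of i] f(3)[of "Suc i"] i 2 by simp_all
      then have "f i = f (Suc i)"
        using RB sym by (auto simp: C_def split: if_splits)
      then show False using f(2)[of i] by simp
    qed (use f(2)[of i] i in auto)
  qed
  define xs where "xs = map (\<lambda>j. f (i + j)) [0..<l]"
  have len: "length xs = l" by (simp add: xs_def)
  have step: "C (i + j) (xs ! j) (xs ! (Suc j mod l))" if "j < l" for j
  proof (cases "Suc j = l")
    case True
    then show ?thesis using f(3)[of "i + j"] i l by (auto simp: xs_def)
  next
    case False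
    then show ?thesis using f(3)[of "i + j"] that by (auto simp: xs_def)
  qed
  have "distinct xs"
  proof -
    have "f (i + a) \<noteq> f (i + b)" if "a < b" "b < l" for a b
      using least[of "b - a" "i + a"] that by auto
    then show ?thesis
      by (auto simp: xs_def distinct_map inj_on_def) (metis linorder_neqE_nat)
  qed
  moreover have "set xs \<subseteq> J" using f(1) by (auto simp: xs_def)
  moreover have "R (xs ! j) (xs ! (Suc j mod length xs)) \<or> B (xs ! j) (xs ! (Suc j mod length xs))"
    if "j < length xs" for j
    using step[of j] that by (auto simp: len C_def split: if_splits)
  moreover have "\<exists>j<length xs. R (xs ! j) (xs ! (Suc j mod length xs))"
  proof -
    have "\<exists>j<2. even (i + j)" by (cases "even i") (auto intro: exI[of _ 0] exI[of _ 1])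
    then obtain j where "j < 2" "even (i + j)" by blast
    then show ?thesis using step[of j] l3 by (intro exI[of _ j]) (auto simp: len C_def)
  qed
  moreover have "\<exists>j<length xs. B (xs ! j) (xs ! (Suc j mod length xs))"
  proof -
    have "\<exists>j<2. odd (i + j)" by (cases "even i") (auto intro: exI[of _ 0] exI[of _ 1])
    then obtain j where "j < 2" "odd (i + j)" by blast
    then show ?thesis using step[of j] l3 by (intro exI[of _ j]) (auto simp: len C_def)
  qed
  ultimately show ?thesis using that l3 len by auto
qed

text \<open>If no index were alone in one of its classes, every index of J would have a red and a
  blue neighbour within J, and the alternating walk would close up to a two-colored cycle.\<close>

lemma leaf_of_acyclic:
  assumes v: "v1 \<noteq> v2" and nc: "\<not> has_two_colored_cycle p v1 v2"
    and J: "finite J" "J \<noteq> {}"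
  shows "\<exists>k\<in>J. \<exists>v\<in>{v1, v2}. \<forall>m\<in>J. lam p v m = lam p v k \<longrightarrow> m = k"
proof (rule ccontr)
  assume "\<not> ?thesis"
  then have nbr: "\<exists>m\<in>J. m \<noteq> k \<and> lam p v1 k = lam p v1 m"
    "\<exists>m\<in>J. m \<noteq> k \<and> lam p v2 k = lam p v2 m" if "k \<in> J" for k
    using that by (metis insertCI)+
  then have JV: "J \<subseteq> graph_verts p v1 v2"
    by (fastforce simp: graph_verts_def Pi_set_def)
  obtain xs where xs: "distinct xs" "3 \<le> length xs" "set xs \<subseteq> J"
    "\<And>i. i < length xs \<Longrightarrow> lam p v1 (xs ! i) = lam p v1 (xs ! (Suc i mod length xs)) \<or>
      lam p v2 (xs ! i) = lam p v2 (xs ! (Suc i mod length xs))"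
    "\<exists>i<length xs. lam p v1 (xs ! i) = lam p v1 (xs ! (Suc i mod length xs))"
    "\<exists>i<length xs. lam p v2 (xs ! i) = lam p v2 (xs ! (Suc i mod length xs))"
  proof (rule alternating_cycle[of J "\<lambda>k m. lam p v1 k = lam p v1 m" "\<lambda>k m. lam p v2 k = lam p v2 m"])
    show "k = m" if "lam p v1 k = lam p v1 m" "lam p v2 k = lam p v2 m" for k m
      using lam_eq_both_imp_eq[OF v] that .
  qed (use J nbr in simp_all)
  let ?E = "{{xs ! i, xs ! (Suc i mod length xs)} | i. i < length xs}"
  have ne: "xs ! i \<noteq> xs ! (Suc i mod length xs)" if "i < length xs" for i
  proof -
    have "Suc i mod length xs \<noteq> i"
      using that xs(2) by (cases "Suc i = length xs") auto
    moreover have "Suc i mod length xs < length xs"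
      using that by (intro mod_less_divisor) linarith
    ultimately show ?thesis
      using xs(1) that by (auto simp: nth_eq_iff_index_eq)
  qed
  have mem: "xs ! i \<in> graph_verts p v1 v2" "xs ! (Suc i mod length xs) \<in> graph_verts p v1 v2"
    if "i < length xs" for i
  proof -
    have "Suc i mod length xs < length xs"
      using that by (intro mod_less_divisor) linarith
    with that have "xs ! i \<in> set xs" "xs ! (Suc i mod length xs) \<in> set xs" by simp_all
    then show "xs ! i \<in> graph_verts p v1 v2" "xs ! (Suc i mod length xs) \<in> graph_verts p v1 v2"
      using xs(3) JV by blast+
  qed
  have red: "{xs ! i, xs ! (Suc i mod length xs)} \<in> red_edges p v1 v2"
    if "i < length xs" "lam p v1 (xs ! i) = lam p v1 (xs ! (Suc i mod length xs))" for i
    unfolding red_edges_def using that ne mem by blast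
  have blue: "{xs ! i, xs ! (Suc i mod length xs)} \<in> blue_edges p v1 v2"
    if "i < length xs" "lam p v2 (xs ! i) = lam p v2 (xs ! (Suc i mod length xs))" for i
    unfolding blue_edges_def using that ne mem by blast
  have "is_cycle_graph (set xs) ?E"
    using xs by (auto simp: is_cycle_graph_def)
  moreover have "?E \<subseteq> red_edges p v1 v2 \<union> blue_edges p v1 v2"
    using xs(4) red blue by blast
  moreover have "?E \<inter> red_edges p v1 v2 \<noteq> {}" "?E \<inter> blue_edges p v1 v2 \<noteq> {}"
    using xs(5,6) red blue by blast+
  moreover have "set xs \<subseteq> graph_verts p v1 v2" using xs(3) JV by auto
  ultimately have "has_two_colored_cycle p v1 v2"
    unfolding has_two_colored_cycle_def by blast
  with nc show False by simp
qed

section \<open>Coefficients on a cycle whose red and blue class sums all vanish\<close>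

lemma cyclic_set_closed:
  assumes "j \<in> A" "A \<subseteq> {..<n}" "\<And>j. j \<in> A \<Longrightarrow> Suc j mod n \<in> A"
  shows "A = {..<n}"
proof -
  have "(j + i) mod n \<in> A" for i
  proof (induction i)
    case 0
    then show ?case using assms(1,2) by auto
  next
    case (Suc i)
    then show ?case using assms(3)[OF Suc] by (simp add: mod_Suc_eq)
  qed
  moreover have "i = (j + (i + n - j)) mod n" if "i < n" for i
    using that assms(1,2) by auto
  ultimately have "i \<in> A" if "i < n" for i
    using that by metis
  with assms(2) show ?thesis by auto
qed

lemma bij_betw_Suc_mod: "bij_betw (\<lambda>j. Suc j mod n) {..<n} {..<n}"
proof (cases "n = 0")
  case False
  have "inj_on (\<lambda>j. Suc j mod n) {..<n}"
    by (auto simp: inj_on_def mod_Suc split: if_splits)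
  moreover have "(\<lambda>j. Suc j mod n) ` {..<n} \<subseteq> {..<n}" using False by auto
  ultimately show ?thesis
    by (simp add: bij_betw_def endo_inj_surj)
qed (simp add: bij_betw_def)

text \<open>Each red edge lies in one red class, so its difference cancels in every red class sum.
  Over the whole cycle the differences telescope to zero; hence the sum over the red edges is minus
  the sum over the remaining ones, which are blue and cancel in every blue class sum.\<close>

lemma kernel_of_two_colored_cycle:
  assumes v: "v1 \<noteq> v2" and cyc: "has_two_colored_cycle p v1 v2"
  obtains K d where "finite K" "\<And>k. k \<notin> K \<Longrightarrow> d k = 0" "\<exists>k. d k \<noteq> (0::real)"
    "\<And>v \<mu>. v \<in> {v1, v2} \<Longrightarrow> (\<Sum>k | k \<in> K \<and> lam p v k = \<mu>. d k) = 0"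
proof -
  obtain V E where VE: "is_cycle_graph V E" "E \<subseteq> red_edges p v1 v2 \<union> blue_edges p v1 v2"
    "E \<inter> red_edges p v1 v2 \<noteq> {}" "E \<inter> blue_edges p v1 v2 \<noteq> {}"
    using cyc unfolding has_two_colored_cycle_def by blast
  then obtain xs where xs: "distinct xs" "length xs \<ge> 3"
    "E = {{xs ! i, xs ! (Suc i mod length xs)} | i. i < length xs}"
    by (auto simp: is_cycle_graph_def)
  define n where "n = length xs"
  define \<sigma> where "\<sigma> j = Suc j mod n" for j
  have \<sigma>: "bij_betw \<sigma> {..<n} {..<n}"
    using bij_betw_Suc_mod[of n] by (simp add: \<sigma>_def[abs_def])
  have \<sigma>_less: "\<sigma> j < n" if "j < n" for j using that by (simp add: \<sigma>_def)
  have E: "E = {{xs ! i, xs ! \<sigma> i} | i. i < n}"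
    by (simp add: xs(3) n_def \<sigma>_def)
  have red_iff: "{x, y} \<in> red_edges p v1 v2 \<Longrightarrow> lam p v1 x = lam p v1 y \<and> x \<noteq> y" for x y
    by (auto simp: red_edges_def doubleton_eq_iff)
  have blue_iff: "{x, y} \<in> blue_edges p v1 v2 \<Longrightarrow> lam p v2 x = lam p v2 y \<and> x \<noteq> y" for x y
    by (auto simp: blue_edges_def doubleton_eq_iff)
  define A where "A = {j. j < n \<and> lam p v1 (xs ! j) = lam p v1 (xs ! \<sigma> j)}"
  have blueA: "lam p v2 (xs ! j) = lam p v2 (xs ! \<sigma> j)" if "j < n" "j \<notin> A" for j
  proof -
    have "{xs ! j, xs ! \<sigma> j} \<in> E" using that E by blast
    then show ?thesis using VE(2) red_iff blue_iff that by (auto simp: A_def)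
  qed
  have "\<exists>j. j \<in> A"
    using VE(3) red_iff E unfolding A_def by blast
  moreover have "A \<noteq> {..<n}"
  proof -
    obtain j where "j < n" "{xs ! j, xs ! \<sigma> j} \<in> blue_edges p v1 v2" using VE(4) E by blast
    then have "j \<notin> A"
      using blue_iff[of "xs ! j" "xs ! \<sigma> j"] lam_eq_both_imp_eq[OF v, of p "xs ! j" "xs ! \<sigma> j"]
      by (auto simp: A_def)
    then show ?thesis using \<open>j < n\<close> by auto
  qed
  \<comment> \<open>A red edge followed by a blue one. Their common vertex
    \<open>xs ! \<sigma> j0\<close> is met by only one red edge, hence the coefficient there is -1
    and \<open>d\<close> is not zero.\<close>
  ultimately obtain j0 where j0: "j0 \<in> A" "\<sigma> j0 \<notin> A"
    using cyclic_set_closed[of _ A n] by (auto simp: A_def \<sigma>_def)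
  \<comment> \<open>The contribution of edge \<open>j\<close> to the total over the indices
    satisfying \<open>P\<close>. Equality with k as \<open>P\<close> gives the coefficient
    \<open>d k\<close>; membership in a class gives the class sums.\<close>
  define G where "G P j = of_bool (P (xs ! j)) - (of_bool (P (xs ! \<sigma> j)) :: real)" for P j
  have G0: "(\<Sum>j<n. G P j) = 0" for P
    using sum.reindex_bij_betw[OF \<sigma>, of "\<lambda>j. of_bool (P (xs ! j)) :: real"]
    by (simp add: G_def sum_subtractf)
  have A_sub: "A \<subseteq> {..<n}" by (auto simp: A_def)
  have GA: "(\<Sum>j\<in>A. G P j) = - (\<Sum>j\<in>{..<n} - A. G P j)" for P
    using G0[of P] sum.subset_diff[OF A_sub, of "G P"] by simp
  define d where "d k = (\<Sum>j\<in>A. G (\<lambda>x. x = k) j)" for k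
  have sum_d: "(\<Sum>k | k \<in> set xs \<and> P k. d k) = (\<Sum>j\<in>A. G P j)" for P
  proof -
    have *: "(\<Sum>k | k \<in> set xs \<and> P k. of_bool (xs ! j = k)) = (of_bool (P (xs ! j)) :: real)" if "j < n" for j
      using that by (auto simp: of_bool_def n_def sum.If_cases) 
    have "(\<Sum>k | k \<in> set xs \<and> P k. d k) = (\<Sum>j\<in>A. \<Sum>k | k \<in> set xs \<and> P k. G (\<lambda>x. x = k) j)"
      unfolding d_def by (rule sum.swap)
    also have "\<dots> = (\<Sum>j\<in>A. G P j)"
    proof (intro sum.cong refl)
      fix j assume "j \<in> A"
      then have "j < n" "\<sigma> j < n" using A_sub \<sigma>_less by auto
      then show "(\<Sum>k | k \<in> set xs \<and> P k. G (\<lambda>x. x = k) j) = G P j"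
        unfolding G_def sum_subtractf by (simp only: *)
    qed
    finally show ?thesis .
  qed
  show ?thesis
  proof
    show "finite (set xs)" by simp
    show "d k = 0" if "k \<notin> set xs" for k
      unfolding d_def G_def using that A_sub \<sigma>_less n_def
      by (intro sum.neutral) (auto simp: of_bool_def subset_eq)
    have "G (\<lambda>x. x = xs ! \<sigma> j0) j = - of_bool (j = j0)" if "j \<in> A" for j
    proof -
      have "j < n" "j0 < n" "j \<noteq> \<sigma> j0" using that j0 A_sub by auto
      moreover from this have "\<sigma> j = \<sigma> j0 \<longleftrightarrow> j = j0"
        using \<sigma> by (auto simp: bij_betw_def inj_on_def)
      ultimately show ?thesis
        using \<sigma>_less xs(1) by (auto simp: G_def nth_eq_iff_index_eq n_def)
    qed
    then have "d (xs ! \<sigma> j0) = (\<Sum>j\<in>A. - of_bool (j = j0))"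
      by (simp add: d_def)
    also have "\<dots> = -1"
      using j0 finite_subset[OF A_sub] by (simp add: sum_negf of_bool_def)
    finally show "\<exists>k. d k \<noteq> 0" by (intro exI[of _ "xs ! \<sigma> j0"]) simp
    show "(\<Sum>k | k \<in> set xs \<and> lam p v k = \<mu>. d k) = 0" if "v \<in> {v1, v2}" for v \<mu>
    proof (cases "v = v1")
      case True
      then show ?thesis unfolding sum_d
        by (intro sum.neutral) (auto simp: G_def A_def)
    next
      case False
      then have "v = v2" using that by simp
      have "(\<Sum>j\<in>{..<n} - A. G (\<lambda>k. lam p v k = \<mu>) j) = 0"
        using blueA \<open>v = v2\<close> by (intro sum.neutral) (auto simp: G_def)
      then show ?thesis unfolding sum_d GA by simp
    qed
  qed
qed

text \<open>Induction on the size of J, the set of indices not yet controlled. An index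
  \<open>k0\<close> alone in its class within J has only controlled classmates, so its coefficient
  is the class sum minus terms bounded by M. Removing \<open>k0\<close> from J then replaces M by N
  * M.\<close>

lemma peeling:
  fixes p :: "real poly"
  assumes v: "v1 \<noteq> v2" and nc: "\<not> has_two_colored_cycle p v1 v2"
    and fib: "\<And>v \<mu>. finite {m. lam p v m = \<mu>}"
    and J: "finite J"
  shows "\<exists>C\<ge>1. \<forall>K (d :: int \<Rightarrow> complex) M. finite K \<longrightarrow> (\<forall>k. k \<notin> K \<longrightarrow> d k = 0) \<longrightarrow>
    (\<forall>k. \<forall>v\<in>{v1, v2}. cmod (\<Sum>m | m \<in> K \<and> lam p v m = lam p v k. d m) \<le> M) \<longrightarrow>
    (\<forall>m. m \<notin> J \<longrightarrow> cmod (d m) \<le> M) \<longrightarrow> (\<forall>k. cmod (d k) \<le> C * M)"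
  using J
proof (induction "card J" arbitrary: J)
  case 0
  then show ?case by (intro exI[of _ 1]) auto
next
  case (Suc n)
  then have "J \<noteq> {}" by auto
  obtain k0 v where k0: "k0 \<in> J" "v \<in> {v1, v2}" "\<And>m. m \<in> J \<Longrightarrow> lam p v m = lam p v k0 \<Longrightarrow> m = k0"
    using leaf_of_acyclic[OF v nc \<open>finite J\<close> \<open>J \<noteq> {}\<close>] by blast
  have "n = card (J - {k0})" using Suc k0 by simp
  from Suc(1)[OF this] Suc.prems obtain C where C: "1 \<le> C"
    "\<And>K (d :: int \<Rightarrow> complex) M k. finite K \<Longrightarrow> (\<And>k. k \<notin> K \<Longrightarrow> d k = 0) \<Longrightarrow>
    (\<And>k v. v\<in>{v1, v2} \<Longrightarrow> cmod (\<Sum>m | m \<in> K \<and> lam p v m = lam p v k. d m) \<le> M) \<Longrightarrow>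
    (\<And>m. m \<notin> J - {k0} \<Longrightarrow> cmod (d m) \<le> M) \<Longrightarrow> cmod (d k) \<le> C * M"
    by (auto 0 4)
  \<comment> \<open>The class is counted in all integers, not within K, so that the final constant
    does not depend on K.\<close>
  define N where "N = 1 + real (card {m. lam p v m = lam p v k0})"
  have N: "1 \<le> N" by (simp add: N_def)
  have bound: "cmod (d k) \<le> (C * N) * M"
    if K: "finite K" and d: "\<And>k. k \<notin> K \<Longrightarrow> d k = 0"
      and S: "\<And>k v. v \<in> {v1, v2} \<Longrightarrow> cmod (\<Sum>m | m \<in> K \<and> lam p v m = lam p v k. d m) \<le> M"
      and M: "\<And>m. m \<notin> J \<Longrightarrow> cmod (d m) \<le> M" for K d M k
  proof -
    have M0: "0 \<le> M" using S[of v1] norm_ge_zero by (meson insertI1 order_trans)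
    have MN: "M \<le> N * M" using mult_right_mono[OF N M0] by simp
    have "cmod (d k0) \<le> N * M"
    proof (cases "k0 \<in> K")
      case True
      let ?F = "{m. m \<in> K \<and> lam p v m = lam p v k0}"
      have "(\<Sum>m\<in>?F. d m) = d k0 + (\<Sum>m\<in>?F - {k0}. d m)"
        using True K by (subst sum.remove[of _ k0]) auto
      then have "d k0 = (\<Sum>m\<in>?F. d m) - (\<Sum>m\<in>?F - {k0}. d m)" by simp
      also have "cmod \<dots> \<le> cmod (\<Sum>m\<in>?F. d m) + cmod (\<Sum>m\<in>?F - {k0}. d m)"
        by (rule norm_triangle_ineq4)
      also have "\<dots> \<le> M + real (card (?F - {k0})) * M"
        using S[OF k0(2)] k0(3) M by (intro add_mono sum_norm_bound) auto
      also have "\<dots> \<le> M + real (card {m. lam p v m = lam p v k0}) * M"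
        using M0 fib by (intro add_left_mono mult_right_mono of_nat_mono card_mono) auto
      finally show ?thesis by (simp add: N_def algebra_simps)
    qed (use d M0 N in simp)
    then have "cmod (d k) \<le> C * (N * M)"
      using S M MN by (intro C(2)[OF K d]) (auto intro: order_trans)
    then show ?thesis by (simp add: mult.assoc)
  qed
  show ?case
  proof (intro exI[of _ "C * N"] conjI allI impI)
    show "1 \<le> C * N" using mult_mono[OF C(1) N] C(1) by simp
    fix K d M k
    assume "finite K" "\<forall>k. k \<notin> K \<longrightarrow> d k = 0"
      "\<forall>k. \<forall>v\<in>{v1, v2}. cmod (\<Sum>m | m \<in> K \<and> lam p v m = lam p v k. d m) \<le> M"
      "\<forall>m. m \<notin> J \<longrightarrow> cmod (d m) \<le> M"
    then show "cmod (d k) \<le> C * N * M"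
      using bound[of K d M k] by blast
  qed
qed

section \<open>Ingham's inequality with gaps tending to infinity\<close>

text \<open>The weight vanishes at both ends, so two integrations by parts are possible and give
  decay of order 2 in the frequency. Without the weight the decay would be of order 1, which is not
  summable over separated frequencies.\<close>

lemma weighted_exponential_integral:
  fixes a b \<xi> :: real
  assumes ab: "a \<le> b" and \<xi>: "\<xi> \<noteq> 0"
  obtains I where "((\<lambda>t. of_real ((t - a) * (b - t)) * cis (\<xi> * t)) has_integral I) {a..b}"
    "cmod I \<le> 4 * (b - a) / \<xi>\<^sup>2"
proof -
  \<comment> \<open>The boundary terms of the two integrations by parts. The derivative of
    \<open>G\<close> differs from the integrand by 2/xi^2 times the exponential. The values at the
    two ends contribute (b - a)/xi^2 each and the correction at most 2(b - a)/xi^2, whence the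
    factor 4.\<close>
  define G where "G z = ((z - of_real a) * (of_real b - z) / (\<i> * of_real \<xi>)
    + (of_real a + of_real b - 2 * z) / (of_real \<xi>)\<^sup>2) * exp (\<i> * (of_real \<xi> * z))" for z :: complex
  have dG: "(G has_field_derivative ((z - of_real a) * (of_real b - z) - 2 / (of_real \<xi>)\<^sup>2) * exp (\<i> * (of_real \<xi> * z))) (at z)" for z
    unfolding G_def using \<xi>
    by (auto intro!: derivative_eq_intros simp: field_simps power2_eq_square)
  have "((\<lambda>t. G (of_real t)) has_vector_derivative
      (of_real ((t - a) * (b - t)) * cis (\<xi> * t) - 2 / (of_real \<xi>)\<^sup>2 * cis (\<xi> * t))) (at t within {a..b})" for t
    using has_vector_derivative_real_field[OF dG, of t "{a..b}"]
    by (simp add: cis_conv_exp algebra_simps)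
  from fundamental_theorem_of_calculus[OF ab this]
  have 1: "((\<lambda>t. of_real ((t - a) * (b - t)) * cis (\<xi> * t) - 2 / (of_real \<xi>)\<^sup>2 * cis (\<xi> * t)) has_integral G b - G a) {a..b}" .
  have int: "(\<lambda>t. cis (\<xi> * t)) integrable_on {a..b}"
    by (intro integrable_continuous_interval continuous_intros)
  define J where "J = integral {a..b} (\<lambda>t. cis (\<xi> * t))"
  have J: "((\<lambda>t. cis (\<xi> * t)) has_integral J) {a..b}"
    unfolding J_def using int by (rule integrable_integral)
  have "cmod J \<le> 1 * measure lebesgue {a..b}"
    using has_integral_bound[of 1 "\<lambda>t. cis (\<xi> * t)" J a b] J by simp
  then have J_le: "cmod J \<le> b - a" using ab by simp
  have I: "((\<lambda>t. of_real ((t - a) * (b - t)) * cis (\<xi> * t)) has_integral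
      G b - G a + 2 / (of_real \<xi>)\<^sup>2 * J) {a..b}"
    using has_integral_add[OF 1 has_integral_mult_right[OF J, of "2 / (of_real \<xi>)\<^sup>2"]]
    by simp
  have "cmod (G b) = (b - a) / \<xi>\<^sup>2" "cmod (G a) = (b - a) / \<xi>\<^sup>2"
  proof -
    have "G (of_real b) = of_real ((a - b) / \<xi>\<^sup>2) * cis (\<xi> * b)"
      "G (of_real a) = of_real ((b - a) / \<xi>\<^sup>2) * cis (\<xi> * a)"
      by (simp_all add: G_def cis_conv_exp)
    then show "cmod (G b) = (b - a) / \<xi>\<^sup>2" "cmod (G a) = (b - a) / \<xi>\<^sup>2"
      using ab by (simp_all only: norm_mult norm_cis norm_of_real) simp_all
  qed
  moreover have "cmod (2 / (of_real \<xi>)\<^sup>2 * J) \<le> 2 / \<xi>\<^sup>2 * (b - a)"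
    unfolding norm_mult using J_le by (intro mult_mono) (auto simp: norm_divide norm_power)
  moreover have "cmod (G b - G a + 2 / (of_real \<xi>)\<^sup>2 * J) \<le> cmod (G b) + cmod (G a) + cmod (2 / (of_real \<xi>)\<^sup>2 * J)"
    by (metis add_right_mono norm_triangle_ineq norm_triangle_ineq4 order_trans)
  moreover have "2 / \<xi>\<^sup>2 * (b - a) = 2 * ((b - a) / \<xi>\<^sup>2)" "4 * (b - a) / \<xi>\<^sup>2 = 4 * ((b - a) / \<xi>\<^sup>2)"
    by simp_all
  ultimately have "cmod (G b - G a + 2 / (of_real \<xi>)\<^sup>2 * J) \<le> 4 * (b - a) / \<xi>\<^sup>2"
    by linarith
  with I that show ?thesis by blast
qed

lemma weight_integral:
  fixes a b :: real
  assumes "a \<le> b"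
  shows "((\<lambda>t. (t - a) * (b - t)) has_integral (b - a) ^ 3 / 6) {a..b}"
proof -
  have "((\<lambda>t. (a + b) * t\<^sup>2 / 2 - t ^ 3 / 3 - a * b * t) has_vector_derivative (t - a) * (b - t)) (at t within {a..b})" for t
    unfolding has_real_derivative_iff_has_vector_derivative[symmetric]
    by (auto intro!: derivative_eq_intros simp: field_simps power2_eq_square)
  from fundamental_theorem_of_calculus[OF assms this] show ?thesis
    by (rule back_subst) (simp add: field_simps power2_eq_square power3_eq_cube)
qed

lemma sum_inverse_squares_le: "(\<Sum>n=1..N. 1 / (real n)\<^sup>2) \<le> 2"
proof -
  have "(\<Sum>n=1..Suc N. 1 / (real n)\<^sup>2) \<le> 2 - 1 / real (Suc N)" for N
  proof (induction N)
    case (Suc N)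
    have "1 / (real (Suc (Suc N)))\<^sup>2 \<le> 1 / (real (Suc N) * real (Suc (Suc N)))"
      by (intro divide_left_mono) (auto simp: power2_eq_square)
    also have "\<dots> = 1 / real (Suc N) - 1 / real (Suc (Suc N))"
      by (simp add: field_simps)
    finally show ?case using Suc by simp
  qed simp
  from this[of "N - 1"] show ?thesis
    by (cases N) (auto intro: order_trans)
qed

section \<open>Ingham inequalities for separated frequencies\<close>

definition separated :: "real \<Rightarrow> real set \<Rightarrow> bool" where
  "separated \<gamma> A \<longleftrightarrow> (\<forall>x\<in>A. \<forall>y\<in>A. x \<noteq> y \<longrightarrow> \<gamma> \<le> \<bar>x - y\<bar>)"

lemma separated_subset: "separated \<gamma> A \<Longrightarrow> B \<subseteq> A \<Longrightarrow> separated \<gamma> B"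
  by (auto simp: separated_def)

text \<open>By separation, x is determined within A by the integer part n of x/gamma, so the sum is
  dominated by the sum of 1/(n gamma)^2 over distinct n >= 1.\<close>

lemma sum_inverse_square_separated_pos:
  assumes "0 < \<gamma>" "finite A" "separated \<gamma> A" "\<And>x. x \<in> A \<Longrightarrow> \<gamma> \<le> x"
  shows "(\<Sum>x\<in>A. 1 / x\<^sup>2) \<le> 2 / \<gamma>\<^sup>2"
proof -
  define n where "n x = nat \<lfloor>x / \<gamma>\<rfloor>" for x
  have n1: "1 \<le> n x" "real (n x) * \<gamma> \<le> x" "x < (real (n x) + 1) * \<gamma>" if "x \<in> A" for x
  proof -
    have "1 \<le> x / \<gamma>" using assms(1,4) that by simp
    then have fl: "1 \<le> \<lfloor>x / \<gamma>\<rfloor>" by simp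
    then have "0 < \<lfloor>x / \<gamma>\<rfloor>" by linarith
    then have "0 < n x" unfolding n_def by (simp only: zero_less_nat_eq)
    then show "1 \<le> n x" by simp
    have r: "real (n x) = of_int \<lfloor>x / \<gamma>\<rfloor>" using fl by (simp add: n_def)
    have "real (n x) \<le> x / \<gamma>" "x / \<gamma> < real (n x) + 1" unfolding r by linarith+
    then show "real (n x) * \<gamma> \<le> x" "x < (real (n x) + 1) * \<gamma>"
      using assms(1) by (simp_all add: field_simps)
  qed
  have inj: "inj_on n A"
  proof (rule inj_onI, rule ccontr)
    fix x y assume xy: "x \<in> A" "y \<in> A" "n x = n y" "x \<noteq> y"
    have "\<bar>x - y\<bar> < \<gamma>"
      using n1[OF xy(1)] n1[OF xy(2)] xy(3) by (simp add: abs_less_iff algebra_simps)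
    moreover have "\<gamma> \<le> \<bar>x - y\<bar>" using assms(3) xy unfolding separated_def by blast
    ultimately show False by simp
  qed
  have "(\<Sum>x\<in>A. 1 / x\<^sup>2) \<le> (\<Sum>x\<in>A. 1 / (real (n x))\<^sup>2 * (1 / \<gamma>\<^sup>2))"
  proof (rule sum_mono)
    fix x assume x: "x \<in> A"
    have "1 / x\<^sup>2 \<le> 1 / (real (n x) * \<gamma>)\<^sup>2"
      using n1[OF x] assms(1) less_le_trans[OF assms(1) assms(4)[OF x]]
      by (intro divide_left_mono power_mono mult_pos_pos zero_less_power) auto
    then show "1 / x\<^sup>2 \<le> 1 / (real (n x))\<^sup>2 * (1 / \<gamma>\<^sup>2)" by (simp add: power_mult_distrib)
  qed
  also have "\<dots> = (\<Sum>m\<in>n ` A. 1 / (real m)\<^sup>2) * (1 / \<gamma>\<^sup>2)"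
    by (simp only: sum.reindex[OF inj] sum_distrib_right o_def)
  also have "\<dots> \<le> 2 * (1 / \<gamma>\<^sup>2)"
  proof (intro mult_right_mono)
    have "(\<Sum>m\<in>n ` A. 1 / (real m)\<^sup>2) \<le> (\<Sum>m=1..Max (insert 0 (n ` A)). 1 / (real m)\<^sup>2)"
      using assms(2) n1(1) by (intro sum_mono2) auto
    also have "\<dots> \<le> 2" by (rule sum_inverse_squares_le)
    finally show "(\<Sum>m\<in>n ` A. 1 / (real m)\<^sup>2) \<le> 2" .
  qed simp
  finally show ?thesis by simp
qed

lemma sum_inverse_square_separated:
  assumes "0 < \<gamma>" "finite F" "separated \<gamma> F" "\<mu> \<in> F"
  shows "(\<Sum>\<nu>\<in>F - {\<mu>}. 1 / (\<mu> - \<nu>)\<^sup>2) \<le> 4 / \<gamma>\<^sup>2"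
proof -
  have sep: "\<gamma> \<le> \<bar>\<mu> - \<nu>\<bar>" if "\<nu> \<in> F" "\<nu> \<noteq> \<mu>" for \<nu>
    using assms(3,4) that by (auto simp: separated_def)
  let ?L = "{\<nu>\<in>F. \<nu> < \<mu>}" and ?R = "{\<nu>\<in>F. \<mu> < \<nu>}"
  have "(\<Sum>x\<in>(\<lambda>\<nu>. \<mu> - \<nu>) ` ?L. 1 / x\<^sup>2) \<le> 2 / \<gamma>\<^sup>2"
    using assms sep by (intro sum_inverse_square_separated_pos) (fastforce simp: separated_def)+
  then have L: "(\<Sum>\<nu>\<in>?L. 1 / (\<mu> - \<nu>)\<^sup>2) \<le> 2 / \<gamma>\<^sup>2"
    by (subst (asm) sum.reindex) (auto simp: inj_on_def)
  have "(\<Sum>x\<in>(\<lambda>\<nu>. \<nu> - \<mu>) ` ?R. 1 / x\<^sup>2) \<le> 2 / \<gamma>\<^sup>2"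
    using assms sep by (intro sum_inverse_square_separated_pos) (fastforce simp: separated_def)+
  then have R: "(\<Sum>\<nu>\<in>?R. 1 / (\<mu> - \<nu>)\<^sup>2) \<le> 2 / \<gamma>\<^sup>2"
    by (subst (asm) sum.reindex) (auto simp: inj_on_def power2_commute)
  have "F - {\<mu>} = ?L \<union> ?R" by auto
  then have "(\<Sum>\<nu>\<in>F - {\<mu>}. 1 / (\<mu> - \<nu>)\<^sup>2) = (\<Sum>\<nu>\<in>?L. 1 / (\<mu> - \<nu>)\<^sup>2) + (\<Sum>\<nu>\<in>?R. 1 / (\<mu> - \<nu>)\<^sup>2)"
    using assms(2) by (simp add: sum.union_disjoint disjoint_iff)
  with L R show ?thesis by simp
qed

text \<open>Coefficients are attached to frequencies rather than to indices. Indices with equal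
  frequency are thereby merged, and the coefficients of a restricted solution become class sums up
  to a phase.\<close>

definition expsum :: "real set \<Rightarrow> (real \<Rightarrow> complex) \<Rightarrow> real \<Rightarrow> complex" where
  "expsum F c t = (\<Sum>\<mu>\<in>F. c \<mu> * cis (\<mu> * t))"

lemma continuous_on_expsum [continuous_intros]:
  "continuous_on A f \<Longrightarrow> continuous_on A (\<lambda>t. expsum F c (f t))"
  unfolding expsum_def by (intro continuous_intros)

text \<open>Expand the square. The diagonal yields the integral of the weight, (b - a)^3 / 6. Off
  the diagonal, 2|xy| <= |x|^2 + |y|^2 and the symmetry of the kernel reduce everything to row sums
  of 1/(mu - nu)^2, at most 4/gamma^2; with the factor 4(b - a) this makes 16(b -
  a)/gamma^2.\<close>

lemma expsum_gram:
  fixes a b :: real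
  assumes ab: "a \<le> b" and \<gamma>: "0 < \<gamma>" and F: "finite F" "separated \<gamma> F"
  shows "\<bar>integral {a..b} (\<lambda>t. (t - a) * (b - t) * (cmod (expsum F c t))\<^sup>2)
    - (b - a) ^ 3 / 6 * (\<Sum>\<mu>\<in>F. (cmod (c \<mu>))\<^sup>2)\<bar> \<le> 16 * (b - a) / \<gamma>\<^sup>2 * (\<Sum>\<mu>\<in>F. (cmod (c \<mu>))\<^sup>2)"
proof -
  have "\<exists>I. ((\<lambda>t. of_real ((t - a) * (b - t)) * cis (\<xi> * t)) has_integral I) {a..b} \<and>
    (if \<xi> = 0 then I = of_real ((b - a) ^ 3 / 6) else cmod I \<le> 4 * (b - a) / \<xi>\<^sup>2)" for \<xi>
  proof (cases "\<xi> = 0")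
    case True
    then show ?thesis
      using has_integral_of_real[OF weight_integral[OF ab], where 'b = complex] by auto
  next
    case False
    then show ?thesis using weighted_exponential_integral[OF ab False] by auto
  qed
  then obtain I where I: "\<And>\<xi>. ((\<lambda>t. of_real ((t - a) * (b - t)) * cis (\<xi> * t)) has_integral I \<xi>) {a..b}"
    "I 0 = of_real ((b - a) ^ 3 / 6)" "\<And>\<xi>. \<xi> \<noteq> 0 \<Longrightarrow> cmod (I \<xi>) \<le> 4 * (b - a) / \<xi>\<^sup>2"
    by metis
  define N where "N = (\<Sum>\<mu>\<in>F. (cmod (c \<mu>))\<^sup>2)"
  define S where "S = (\<Sum>\<mu>\<in>F. \<Sum>\<nu>\<in>F. c \<mu> * cnj (c \<nu>) * I (\<mu> - \<nu>))"
  have "of_real ((t - a) * (b - t) * (cmod (expsum F c t))\<^sup>2) =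
    (\<Sum>\<mu>\<in>F. \<Sum>\<nu>\<in>F. c \<mu> * cnj (c \<nu>) * (of_real ((t - a) * (b - t)) * cis ((\<mu> - \<nu>) * t)))" for t
  proof -
    have "of_real ((cmod (expsum F c t))\<^sup>2) = expsum F c t * cnj (expsum F c t)"
      by (rule complex_norm_square)
    also have "\<dots> = (\<Sum>\<mu>\<in>F. \<Sum>\<nu>\<in>F. c \<mu> * cnj (c \<nu>) * cis ((\<mu> - \<nu>) * t))"
      unfolding expsum_def cnj_sum sum_product
    proof (intro sum.cong refl)
      fix \<mu> \<nu>
      have "c \<mu> * cis (\<mu> * t) * cnj (c \<nu> * cis (\<nu> * t)) = c \<mu> * cnj (c \<nu>) * (cis (\<mu> * t) * cis (- (\<nu> * t)))"
        by (simp add: cis_cnj mult_ac)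
      then show "c \<mu> * cis (\<mu> * t) * cnj (c \<nu> * cis (\<nu> * t)) = c \<mu> * cnj (c \<nu>) * cis ((\<mu> - \<nu>) * t)"
        by (simp only: cis_mult) (simp add: left_diff_distrib)
    qed
    finally show ?thesis by (simp add: sum_distrib_left mult_ac)
  qed
  then have "((\<lambda>t. complex_of_real ((t - a) * (b - t) * (cmod (expsum F c t))\<^sup>2)) has_integral S) {a..b}"
    unfolding S_def by (simp only:) (intro has_integral_sum has_integral_mult_right I(1) F)
  from has_integral_linear[OF this bounded_linear_Re]
  have "((\<lambda>t. (t - a) * (b - t) * (cmod (expsum F c t))\<^sup>2) has_integral Re S) {a..b}"
    by (simp only: o_def Re_complex_of_real)
  then have int: "integral {a..b} (\<lambda>t. (t - a) * (b - t) * (cmod (expsum F c t))\<^sup>2) = Re S"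
    by (rule integral_unique)
  define D where "D = (\<Sum>\<mu>\<in>F. \<Sum>\<nu>\<in>F - {\<mu>}. c \<mu> * cnj (c \<nu>) * I (\<mu> - \<nu>))"
  have "S = (\<Sum>\<mu>\<in>F. c \<mu> * cnj (c \<mu>) * I 0 + (\<Sum>\<nu>\<in>F - {\<mu>}. c \<mu> * cnj (c \<nu>) * I (\<mu> - \<nu>)))"
    unfolding S_def using F by (intro sum.cong refl) (subst sum.remove, auto)
  also have "\<dots> = of_real ((b - a) ^ 3 / 6 * N) + D"
    unfolding sum.distrib D_def N_def I(2) complex_norm_square[symmetric]
    by (simp add: sum_distrib_left mult.commute)
  finally have "Re S - (b - a) ^ 3 / 6 * N = Re D" by simp
  moreover have "\<bar>Re D\<bar> \<le> 16 * (b - a) / \<gamma>\<^sup>2 * N"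
  proof -
    define k where "k \<mu> \<nu> = 1 / (\<mu> - \<nu>)\<^sup>2" for \<mu> \<nu> :: real
    have "\<bar>Re D\<bar> \<le> cmod D" by (rule abs_Re_le_cmod)
    also have "\<dots> \<le> (\<Sum>\<mu>\<in>F. \<Sum>\<nu>\<in>F - {\<mu>}. cmod (c \<mu> * cnj (c \<nu>) * I (\<mu> - \<nu>)))"
      unfolding D_def by (intro sum_norm_le order_refl)
    also have "\<dots> \<le> (\<Sum>\<mu>\<in>F. \<Sum>\<nu>\<in>F - {\<mu>}. 4 * (b - a) * (((cmod (c \<mu>))\<^sup>2 / 2 + (cmod (c \<nu>))\<^sup>2 / 2) * k \<mu> \<nu>))"
    proof (intro sum_mono)
      fix \<mu> \<nu> assume "\<nu> \<in> F - {\<mu>}"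
      then have "cmod (I (\<mu> - \<nu>)) \<le> 4 * (b - a) * k \<mu> \<nu>" using I(3)[of "\<mu> - \<nu>"] by (simp add: k_def)
      moreover have "cmod (c \<mu>) * cmod (c \<nu>) \<le> (cmod (c \<mu>))\<^sup>2 / 2 + (cmod (c \<nu>))\<^sup>2 / 2"
        using sum_squares_bound[of "cmod (c \<mu>)" "cmod (c \<nu>)"] by simp
      ultimately have "cmod (c \<mu>) * cmod (c \<nu>) * cmod (I (\<mu> - \<nu>)) \<le>
          ((cmod (c \<mu>))\<^sup>2 / 2 + (cmod (c \<nu>))\<^sup>2 / 2) * (4 * (b - a) * k \<mu> \<nu>)"
        by (intro mult_mono) auto
      then show "cmod (c \<mu> * cnj (c \<nu>) * I (\<mu> - \<nu>)) \<le> 4 * (b - a) * (((cmod (c \<mu>))\<^sup>2 / 2 + (cmod (c \<nu>))\<^sup>2 / 2) * k \<mu> \<nu>)"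
        by (simp add: norm_mult mult_ac)
    qed
    also have "\<dots> = 4 * (b - a) * ((\<Sum>\<mu>\<in>F. \<Sum>\<nu>\<in>F - {\<mu>}. (cmod (c \<mu>))\<^sup>2 / 2 * k \<mu> \<nu>) +
        (\<Sum>\<mu>\<in>F. \<Sum>\<nu>\<in>F - {\<mu>}. (cmod (c \<nu>))\<^sup>2 / 2 * k \<mu> \<nu>))"
      by (simp add: sum_distrib_left sum.distrib distrib_right distrib_left)
    also have "(\<Sum>\<mu>\<in>F. \<Sum>\<nu>\<in>F - {\<mu>}. (cmod (c \<nu>))\<^sup>2 / 2 * k \<mu> \<nu>) = (\<Sum>\<mu>\<in>F. \<Sum>\<nu>\<in>F - {\<mu>}. (cmod (c \<mu>))\<^sup>2 / 2 * k \<mu> \<nu>)"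
    proof -
      have "(\<Sum>\<mu>\<in>F. \<Sum>\<nu>\<in>F - {\<mu>}. (cmod (c \<nu>))\<^sup>2 / 2 * k \<mu> \<nu>) = (\<Sum>\<mu>\<in>F. \<Sum>\<nu> | \<nu> \<in> F \<and> \<nu> \<noteq> \<mu>. (cmod (c \<nu>))\<^sup>2 / 2 * k \<mu> \<nu>)"
        by (intro sum.cong) auto
      also have "\<dots> = (\<Sum>\<nu>\<in>F. \<Sum>\<mu> | \<mu> \<in> F \<and> \<nu> \<noteq> \<mu>. (cmod (c \<nu>))\<^sup>2 / 2 * k \<mu> \<nu>)"
        using F by (intro sum.swap_restrict) auto
      also have "\<dots> = (\<Sum>\<mu>\<in>F. \<Sum>\<nu>\<in>F - {\<mu>}. (cmod (c \<mu>))\<^sup>2 / 2 * k \<mu> \<nu>)"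
        by (intro sum.cong) (auto simp: k_def power2_commute)
      finally show ?thesis .
    qed
    also have "4 * (b - a) * ((\<Sum>\<mu>\<in>F. \<Sum>\<nu>\<in>F - {\<mu>}. (cmod (c \<mu>))\<^sup>2 / 2 * k \<mu> \<nu>) +
        (\<Sum>\<mu>\<in>F. \<Sum>\<nu>\<in>F - {\<mu>}. (cmod (c \<mu>))\<^sup>2 / 2 * k \<mu> \<nu>)) \<le> 4 * (b - a) * (2 / \<gamma>\<^sup>2 * N + 2 / \<gamma>\<^sup>2 * N)"
    proof -
      have "(\<Sum>\<mu>\<in>F. \<Sum>\<nu>\<in>F - {\<mu>}. (cmod (c \<mu>))\<^sup>2 / 2 * k \<mu> \<nu>) \<le> (\<Sum>\<mu>\<in>F. (cmod (c \<mu>))\<^sup>2 / 2 * (4 / \<gamma>\<^sup>2))"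
        unfolding sum_distrib_left[symmetric] k_def
        using \<gamma> F by (intro sum_mono mult_left_mono sum_inverse_square_separated) auto
      also have "\<dots> = 2 / \<gamma>\<^sup>2 * N"
        by (simp add: N_def sum_distrib_left mult.commute)
      finally show ?thesis using ab by (intro mult_left_mono add_mono) auto
    qed
    also have "\<dots> = 16 * (b - a) / \<gamma>\<^sup>2 * N" by simp
    finally show ?thesis .
  qed
  ultimately show ?thesis unfolding int N_def by simp
qed

lemma integrable_expsum_sq [simp, intro]:
  "(\<lambda>t. (cmod (expsum F c t))\<^sup>2) integrable_on {a..b}"
  by (intro integrable_continuous_interval continuous_intros)

lemma integrable_weight_expsum_sq [simp, intro]:
  fixes a b :: real
  shows "(\<lambda>t. (t - u) * (w - t) * (cmod (expsum F c t))\<^sup>2) integrable_on {a..b}"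
  by (intro integrable_continuous_interval continuous_intros)

definition ingham_lower :: "real set \<Rightarrow> real \<Rightarrow> bool" where
  "ingham_lower \<Lambda> T \<longleftrightarrow> (\<exists>C>0. \<forall>F c. finite F \<longrightarrow> F \<subseteq> \<Lambda> \<longrightarrow>
     (\<Sum>\<mu>\<in>F. (cmod (c \<mu>))\<^sup>2) \<le> C * integral {0..T} (\<lambda>t. (cmod (expsum F c t))\<^sup>2))"

text \<open>The number 14 is chosen so that (gamma T)^2 >= 196 > 192; then the off-diagonal error is
  at most half of the diagonal term T^3/6. The weight is at most T^2/4, and T^3/12 against T^2/4
  leaves the constant 3/T.\<close>

lemma ingham_lower_separated:
  assumes T: "0 < T" and sep: "separated \<gamma> \<Lambda>" and \<gamma>: "14 / T \<le> \<gamma>"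
  shows "ingham_lower \<Lambda> T"
  unfolding ingham_lower_def
proof (intro exI[of _ "3 / T"] conjI allI impI)
  show "0 < 3 / T" using T by simp
  fix F c assume F: "finite F" "F \<subseteq> \<Lambda>"
  define N where "N = (\<Sum>\<mu>\<in>F. (cmod (c \<mu>))\<^sup>2)"
  define W where "W = integral {0..T} (\<lambda>t. (t - 0) * (T - t) * (cmod (expsum F c t))\<^sup>2)"
  have \<gamma>0: "0 < \<gamma>" using \<gamma> T by (meson divide_pos_pos less_le_trans zero_less_numeral)
  have N0: "0 \<le> N" by (simp add: N_def sum_nonneg)
  have "\<bar>W - T ^ 3 / 6 * N\<bar> \<le> 16 * T / \<gamma>\<^sup>2 * N"
    using expsum_gram[of 0 T \<gamma> F c] T \<gamma>0 F separated_subset[OF sep] by (simp add: W_def N_def)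
  then have "T ^ 3 / 6 * N \<le> W + 16 * T / \<gamma>\<^sup>2 * N" by linarith
  moreover have "16 * T / \<gamma>\<^sup>2 * N \<le> T ^ 3 / 12 * N"
  proof (rule mult_right_mono[OF _ N0])
    have "14 \<le> \<gamma> * T" using \<gamma> T by (simp add: field_simps)
    then have "14\<^sup>2 \<le> (\<gamma> * T)\<^sup>2" by (intro power_mono) auto
    then have "192 * T \<le> \<gamma>\<^sup>2 * T\<^sup>2 * T" using T by (intro mult_right_mono) (auto simp: power_mult_distrib)
    then show "16 * T / \<gamma>\<^sup>2 \<le> T ^ 3 / 12"
      using \<gamma>0 by (simp add: field_simps power3_eq_cube power2_eq_square)
  qed
  moreover have "W \<le> T\<^sup>2 / 4 * integral {0..T} (\<lambda>t. (cmod (expsum F c t))\<^sup>2)"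
    unfolding W_def integral_mult_right[symmetric]
  proof (intro integral_le integrable_on_mult_right integrable_expsum_sq integrable_weight_expsum_sq mult_right_mono)
    fix t
    have "0 \<le> (t - T / 2)\<^sup>2" by simp
    then show "(t - 0) * (T - t) \<le> T\<^sup>2 / 4"
      by (simp add: power2_eq_square algebra_simps)
  qed auto
  ultimately have "T ^ 3 / 12 * N \<le> T\<^sup>2 / 4 * integral {0..T} (\<lambda>t. (cmod (expsum F c t))\<^sup>2)" by linarith
  then have "T\<^sup>2 / 12 * (T * N) \<le> T\<^sup>2 / 12 * (3 * integral {0..T} (\<lambda>t. (cmod (expsum F c t))\<^sup>2))"
    by (simp add: power3_eq_cube power2_eq_square)
  then have "T * N \<le> 3 * integral {0..T} (\<lambda>t. (cmod (expsum F c t))\<^sup>2)"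
    using T by (subst (asm) mult_le_cancel_left_pos) auto
  then show "(\<Sum>\<mu>\<in>F. (cmod (c \<mu>))\<^sup>2) \<le> 3 / T * integral {0..T} (\<lambda>t. (cmod (expsum F c t))\<^sup>2)"
    using T by (simp add: N_def field_simps)
qed

text \<open>Use the weight of the tripled interval from -T to 2T, which is at least 2T^2 on the
  middle third. Any positive gap suffices here, since no term has to be absorbed.\<close>

lemma ingham_upper:
  assumes T: "0 < T" and \<gamma>: "0 < \<gamma>" and sep: "separated \<gamma> \<Lambda>"
  obtains C where "0 < C" "\<And>F c. finite F \<Longrightarrow> F \<subseteq> \<Lambda> \<Longrightarrow>
    integral {0..T} (\<lambda>t. (cmod (expsum F c t))\<^sup>2) \<le> C * (\<Sum>\<mu>\<in>F. (cmod (c \<mu>))\<^sup>2)"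
proof -
  define D where "D = (3 * T) ^ 3 / 6 + 16 * (3 * T) / \<gamma>\<^sup>2"
  have D: "0 < D" using T \<gamma> by (simp add: D_def add_pos_pos)
  have "integral {0..T} (\<lambda>t. (cmod (expsum F c t))\<^sup>2) \<le> D / (2 * T\<^sup>2) * (\<Sum>\<mu>\<in>F. (cmod (c \<mu>))\<^sup>2)"
    if F: "finite F" "F \<subseteq> \<Lambda>" for F c
  proof -
    define N where "N = (\<Sum>\<mu>\<in>F. (cmod (c \<mu>))\<^sup>2)"
    let ?w = "\<lambda>t. (t - - T) * (2 * T - t) * (cmod (expsum F c t))\<^sup>2"
    have "2 * T\<^sup>2 * integral {0..T} (\<lambda>t. (cmod (expsum F c t))\<^sup>2) \<le> integral {0..T} ?w"
      unfolding integral_mult_right[symmetric]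
    proof (intro integral_le integrable_on_mult_right integrable_expsum_sq integrable_weight_expsum_sq mult_right_mono)
      fix t assume "t \<in> {0..T}"
      then have "0 \<le> t * (T - t)" by simp
      then show "2 * T\<^sup>2 \<le> (t - - T) * (2 * T - t)"
        by (simp add: power2_eq_square algebra_simps)
    qed auto
    also have "\<dots> \<le> integral {- T..2 * T} ?w"
      using T by (intro integral_subset_le integrable_weight_expsum_sq) auto
    also have "\<dots> \<le> D * N"
    proof -
      have "\<bar>integral {- T..2 * T} ?w - (2 * T - - T) ^ 3 / 6 * N\<bar> \<le> 16 * (2 * T - - T) / \<gamma>\<^sup>2 * N"
        unfolding N_def using T \<gamma> F separated_subset[OF sep] by (intro expsum_gram) auto
      then show ?thesis by (simp add: D_def distrib_right)
    qed
    finally show ?thesis using T by (simp add: N_def field_simps)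
  qed
  then show ?thesis using that[of "D / (2 * T\<^sup>2)"] D T by simp
qed

section \<open>Adding finitely many exceptional frequencies\<close>

lemma one_minus_sinc_lower:
  fixes \<rho> h :: real
  assumes "0 < \<rho>" "0 < h"
  obtains c where "0 < c" "\<And>\<xi>. \<rho> \<le> \<bar>\<xi>\<bar> \<Longrightarrow> c \<le> h - sin (\<xi> * h) / \<xi>"
proof -
  define r where "r = min 1 (\<rho> * h)"
  have r: "0 < r" "r \<le> 1" "r \<le> \<rho> * h" using assms by (auto simp: r_def)
  obtain z where z: "0 < z" "z < r" "sin r - sin 0 = (r - 0) * cos z"
    using MVT2[of 0 r sin cos] r by (auto intro: DERIV_sin)
  have "cos z < cos 0" using z r pi_gt3 by (intro cos_monotone_0_pi) auto
  then have "sin r < r" using z r by simp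
  have mono: "r - sin r \<le> x - sin x" if "r \<le> x" for x
  proof (rule DERIV_nonneg_imp_nondecreasing[OF that])
    fix y
    show "\<exists>d. ((\<lambda>x. x - sin x) has_real_derivative d) (at y) \<and> 0 \<le> d"
      by (intro exI[of _ "1 - cos y"] conjI) (auto intro!: derivative_eq_intros)
  qed
  \<comment> \<open>With x = |xi| h: for x <= 2 the numerator x - sin x stays above r - sin r while
    |xi| <= 2/h; for x > 2 it exceeds x/2 because sin x <= 1. The two entries of the minimum serve
    these two cases.\<close>
  define c where "c = min (h / 2) ((r - sin r) * h / 2)"
  have "c \<le> h - sin (\<xi> * h) / \<xi>" if \<xi>: "\<rho> \<le> \<bar>\<xi>\<bar>" for \<xi>
  proof -
    define x where "x = \<bar>\<xi>\<bar> * h"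
    have x: "r \<le> x" "0 < \<bar>\<xi>\<bar>"
    proof -
      have "\<rho> * h \<le> \<bar>\<xi>\<bar> * h" using \<xi> assms by (intro mult_right_mono) auto
      then show "r \<le> x" "0 < \<bar>\<xi>\<bar>" using \<xi> assms r unfolding x_def by linarith+
    qed
    have eq: "h - sin (\<xi> * h) / \<xi> = (x - sin x) / \<bar>\<xi>\<bar>"
      using x by (auto simp: x_def abs_if field_simps)
    show ?thesis
    proof (cases "x \<le> 2")
      case True
      have "c * \<bar>\<xi>\<bar> \<le> (r - sin r) * h / 2 * \<bar>\<xi>\<bar>" by (intro mult_right_mono) (auto simp: c_def)
      also have "\<dots> = (r - sin r) * (x / 2)" by (simp add: x_def)
      also have "\<dots> \<le> (r - sin r) * 1" using True \<open>sin r < r\<close> by (intro mult_left_mono) auto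
      also have "\<dots> \<le> x - sin x" using mono x by simp
      finally show ?thesis unfolding eq using x by (simp add: pos_le_divide_eq)
    next
      case False
      have "c * \<bar>\<xi>\<bar> \<le> h / 2 * \<bar>\<xi>\<bar>" by (intro mult_right_mono) (auto simp: c_def)
      also have "\<dots> = x / 2" by (simp add: x_def)
      also have "\<dots> \<le> x - sin x" using False sin_le_one[of x] by linarith
      finally show ?thesis unfolding eq using x by (simp add: pos_le_divide_eq)
    qed
  qed
  moreover have "0 < c" using assms \<open>sin r < r\<close> by (simp add: c_def)
  ultimately show ?thesis using that by blast
qed

lemma norm_add_sq_le: "(norm (x + y))\<^sup>2 \<le> 2 * (norm x)\<^sup>2 + 2 * (norm (y::'a::real_normed_vector))\<^sup>2"
proof -
  have "(norm (x + y))\<^sup>2 \<le> (norm x + norm y)\<^sup>2"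
    by (intro power_mono norm_triangle_ineq) auto
  also have "\<dots> \<le> 2 * (norm x)\<^sup>2 + 2 * (norm y)\<^sup>2"
    using sum_squares_bound[of "norm x" "norm y"] by (simp add: power2_sum)
  finally show ?thesis .
qed

lemma norm_cis_minus_one_sq: "(cmod (cis x - 1))\<^sup>2 = 2 - 2 * cos x"
  using sin_cos_squared_add[of x]
  by (simp add: cmod_power2) (simp add: power2_eq_square algebra_simps)

text \<open>Haraux's trick: \<open>g(t) = e\<^bsup>-i\<mu>\<^sub>0\<delta>\<^esup> f(t + \<delta>) - f(t)\<close> contains no frequency \<open>\<mu>\<^sub>0\<close>. Its
  coefficients \<open>c\<^sub>\<mu>(e\<^bsup>i(\<mu> - \<mu>\<^sub>0)\<delta>\<^esup> - 1)\<close> may be small for a single \<open>\<delta>\<close>, but not on average over \<open>\<delta>\<close>.\<close>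

lemma ingham_lower_insert:
  assumes low: "ingham_lower \<Lambda> S" and S: "0 < S" "S < T"
    and \<rho>: "0 < \<rho>" "separated \<rho> (insert \<mu>0 \<Lambda>)" and \<mu>0: "\<mu>0 \<notin> \<Lambda>"
  shows "ingham_lower (insert \<mu>0 \<Lambda>) T"
proof -
  define h where "h = T - S"
  have h: "0 < h" and T: "0 < T" using S by (auto simp: h_def)
  obtain C where C: "0 < C" "\<And>F c. finite F \<Longrightarrow> F \<subseteq> \<Lambda> \<Longrightarrow>
     (\<Sum>\<mu>\<in>F. (cmod (c \<mu>))\<^sup>2) \<le> C * integral {0..S} (\<lambda>t. (cmod (expsum F c t))\<^sup>2)"
    using low by (auto simp: ingham_lower_def)
  obtain U where U: "0 < U" "\<And>F c. finite F \<Longrightarrow> F \<subseteq> \<Lambda> \<Longrightarrow>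
    integral {0..T} (\<lambda>t. (cmod (expsum F c t))\<^sup>2) \<le> U * (\<Sum>\<mu>\<in>F. (cmod (c \<mu>))\<^sup>2)"
    using ingham_upper[OF T \<rho>(1) separated_subset[OF \<rho>(2)], of \<Lambda>] by blast
  \<comment> \<open>The integral of 1 - cos(xi * delta) over delta from 0 to h is h - sin(xi *
    h)/xi, so \<open>\<kappa>\<close> bounds the averaged damping factors from below, uniformly in
    the frequency.\<close>
  obtain \<kappa> where \<kappa>: "0 < \<kappa>" "\<And>\<xi>. \<rho> \<le> \<bar>\<xi>\<bar> \<Longrightarrow> \<kappa> \<le> h - sin (\<xi> * h) / \<xi>"
    using one_minus_sinc_lower[OF \<rho>(1) h] by blast
  define D where "D = 2 * C * h / \<kappa>"
  define D' where "D' = D + (2 + 2 * U * D) / T"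
  have D: "0 < D" using C h \<kappa> by (simp add: D_def)
  have main: "(\<Sum>\<mu>\<in>F. (cmod (c \<mu>))\<^sup>2) + (cmod a)\<^sup>2 \<le> D' * integral {0..T} (\<lambda>t. (cmod (f t))\<^sup>2)"
    if F: "finite F" "F \<subseteq> \<Lambda>" and f: "\<And>t. f t = expsum F c t + a * cis (\<mu>0 * t)" for F c a f
  proof -
    define Q where "Q = integral {0..T} (\<lambda>t. (cmod (f t))\<^sup>2)"
    define N where "N = (\<Sum>\<mu>\<in>F. (cmod (c \<mu>))\<^sup>2)"
    have cont_f: "continuous_on A f" for A
      unfolding f by (intro continuous_intros)
    have cont: "continuous_on A (\<lambda>t. (cmod (f (t + \<delta>)))\<^sup>2)" for A \<delta>
      by (intro continuous_intros continuous_on_compose2[OF cont_f[of UNIV]]) auto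
    have int: "(\<lambda>t. (cmod (f (t + \<delta>)))\<^sup>2) integrable_on {u..w}" for \<delta> u w
      by (intro integrable_continuous_interval cont)
    note int0 = int[of 0, simplified]
    \<comment> \<open>A shift by at most h = T - S keeps the window of length S inside the interval
      from 0 to T; this is where the additional time is spent.\<close>
    have avg: "(\<Sum>\<mu>\<in>F. (cmod (c \<mu>))\<^sup>2 * (2 - 2 * cos ((\<mu> - \<mu>0) * \<delta>))) \<le> 4 * C * Q"
      if \<delta>: "\<delta> \<in> {0..h}" for \<delta>
    proof -
      define b where "b \<mu> = c \<mu> * (cis ((\<mu> - \<mu>0) * \<delta>) - 1)" for \<mu>
      have g: "expsum F b t = cis (- (\<mu>0 * \<delta>)) * f (t + \<delta>) - f t" for t
      proof -
        have "b \<mu> * cis (\<mu> * t) = cis (- (\<mu>0 * \<delta>)) * (c \<mu> * cis (\<mu> * (t + \<delta>))) - c \<mu> * cis (\<mu> * t)" for \<mu>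
        proof -
          have "cis (- (\<mu>0 * \<delta>)) * cis (\<mu> * (t + \<delta>)) = cis ((\<mu> - \<mu>0) * \<delta>) * cis (\<mu> * t)"
            by (simp only: cis_mult) (simp add: algebra_simps)
          then show ?thesis by (simp add: b_def algebra_simps)
        qed
        moreover have "cis (- (\<mu>0 * \<delta>)) * cis (\<mu>0 * (t + \<delta>)) = cis (\<mu>0 * t)"
          by (simp only: cis_mult) (simp add: algebra_simps)
        ultimately show ?thesis
          by (simp add: f expsum_def sum_subtractf sum_distrib_left distrib_left mult.left_commute)
      qed
      have "(\<Sum>\<mu>\<in>F. (cmod (c \<mu>))\<^sup>2 * (2 - 2 * cos ((\<mu> - \<mu>0) * \<delta>))) = (\<Sum>\<mu>\<in>F. (cmod (b \<mu>))\<^sup>2)"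
        by (simp add: b_def norm_mult power_mult_distrib norm_cis_minus_one_sq)
      also have "\<dots> \<le> C * integral {0..S} (\<lambda>t. (cmod (expsum F b t))\<^sup>2)"
        using F by (rule C)
      also have "\<dots> \<le> C * integral {0..S} (\<lambda>t. 2 * (cmod (f (t + \<delta>)))\<^sup>2 + 2 * (cmod (f t))\<^sup>2)"
      proof (intro mult_left_mono integral_le integrable_expsum_sq integrable_add integrable_on_mult_right int int0)
        fix t
        show "(cmod (expsum F b t))\<^sup>2 \<le> 2 * (cmod (f (t + \<delta>)))\<^sup>2 + 2 * (cmod (f t))\<^sup>2"
          using norm_add_sq_le[of "cis (- (\<mu>0 * \<delta>)) * f (t + \<delta>)" "- f t"] unfolding g by (simp add: norm_mult)
      qed (use C in auto)
      also have "integral {0..S} (\<lambda>t. 2 * (cmod (f (t + \<delta>)))\<^sup>2 + 2 * (cmod (f t))\<^sup>2) =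
          2 * integral {0..S} (\<lambda>t. (cmod (f (t + \<delta>)))\<^sup>2) + 2 * integral {0..S} (\<lambda>t. (cmod (f t))\<^sup>2)"
        by (subst integral_add) (simp_all add: int int0 integrable_on_mult_right)
      also have "integral {0..S} (\<lambda>t. (cmod (f (t + \<delta>)))\<^sup>2) = integral {0 + \<delta>..S + \<delta>} (\<lambda>t. (cmod (f t))\<^sup>2)"
        using integral_shift[of 0 \<delta> S "\<lambda>t. (cmod (f t))\<^sup>2"] cont[of _ 0] by (simp add: o_def)
      also have "C * (2 * integral {0 + \<delta>..S + \<delta>} (\<lambda>t. (cmod (f t))\<^sup>2) + 2 * integral {0..S} (\<lambda>t. (cmod (f t))\<^sup>2)) \<le> C * (2 * Q + 2 * Q)"
        unfolding Q_def using C \<delta> S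
        by (intro mult_left_mono add_mono integral_subset_le int0) (auto simp: h_def)
      finally show ?thesis by simp
    qed
    have N_le: "N \<le> D * Q"
    proof -
      have cos_int: "((\<lambda>\<delta>. (cmod (c \<mu>))\<^sup>2 * (2 - 2 * cos ((\<mu> - \<mu>0) * \<delta>))) has_integral
          (cmod (c \<mu>))\<^sup>2 * (2 * h - 2 * (sin ((\<mu> - \<mu>0) * h) / (\<mu> - \<mu>0)))) {0..h}" if "\<mu> \<in> F" for \<mu>
      proof (rule has_integral_mult_right)
        have ne: "\<mu> - \<mu>0 \<noteq> 0" using that F \<mu>0 by auto
        have "((\<lambda>\<delta>. 2 * \<delta> - 2 * (sin ((\<mu> - \<mu>0) * \<delta>) / (\<mu> - \<mu>0))) has_vector_derivative 2 - 2 * cos ((\<mu> - \<mu>0) * \<delta>)) (at \<delta> within {0..h})" for \<delta>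
          unfolding has_real_derivative_iff_has_vector_derivative[symmetric] using ne
          by (auto intro!: derivative_eq_intros)
        from fundamental_theorem_of_calculus[OF _ this] h
        show "((\<lambda>\<delta>. 2 - 2 * cos ((\<mu> - \<mu>0) * \<delta>)) has_integral 2 * h - 2 * (sin ((\<mu> - \<mu>0) * h) / (\<mu> - \<mu>0))) {0..h}"
          by auto
      qed
      have "(\<Sum>\<mu>\<in>F. (cmod (c \<mu>))\<^sup>2 * (2 * h - 2 * (sin ((\<mu> - \<mu>0) * h) / (\<mu> - \<mu>0)))) \<le> 4 * C * Q * h"
      proof (rule has_integral_le[OF has_integral_sum[OF F(1) cos_int]])
        show "((\<lambda>\<delta>. 4 * C * Q) has_integral 4 * C * Q * h) {0..h}"
          using has_integral_const_real[of "4 * C * Q" 0 h] h by (simp add: mult.commute)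
      qed (use avg in auto)
      moreover have "(\<Sum>\<mu>\<in>F. (cmod (c \<mu>))\<^sup>2 * (2 * \<kappa>)) \<le> (\<Sum>\<mu>\<in>F. (cmod (c \<mu>))\<^sup>2 * (2 * h - 2 * (sin ((\<mu> - \<mu>0) * h) / (\<mu> - \<mu>0))))"
      proof (intro sum_mono mult_left_mono)
        fix \<mu> assume "\<mu> \<in> F"
        then have "\<rho> \<le> \<bar>\<mu> - \<mu>0\<bar>" using \<rho>(2) F \<mu>0 by (auto simp: separated_def)
        from \<kappa>(2)[OF this] show "2 * \<kappa> \<le> 2 * h - 2 * (sin ((\<mu> - \<mu>0) * h) / (\<mu> - \<mu>0))" by simp
      qed auto
      ultimately have "N * (2 * \<kappa>) \<le> 4 * C * Q * h"
        by (simp add: N_def sum_distrib_right)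
      then show ?thesis using \<kappa> by (simp add: D_def field_simps)
    qed
    \<comment> \<open>The new coefficient is recovered by subtraction: its exponential is
      \<open>f\<close> minus the old sum, whose integral the upper inequality bounds by the energy
      just estimated.\<close>
    have "(cmod a)\<^sup>2 * T = integral {0..T} (\<lambda>t. (cmod a)\<^sup>2)" using T by simp
    also have "\<dots> \<le> integral {0..T} (\<lambda>t. 2 * (cmod (f t))\<^sup>2 + 2 * (cmod (expsum F c t))\<^sup>2)"
    proof (intro integral_le integrable_add integrable_on_mult_right int0 integrable_expsum_sq)
      fix t
      have "a * cis (\<mu>0 * t) = f t + - expsum F c t" by (simp add: f)
      then have "cmod a = cmod (f t + - expsum F c t)" by (metis mult.right_neutral norm_cis norm_mult)
      then show "(cmod a)\<^sup>2 \<le> 2 * (cmod (f t))\<^sup>2 + 2 * (cmod (expsum F c t))\<^sup>2"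
        using norm_add_sq_le[of "f t" "- expsum F c t"] by simp
    qed auto
    also have "\<dots> = 2 * Q + 2 * integral {0..T} (\<lambda>t. (cmod (expsum F c t))\<^sup>2)"
      unfolding Q_def by (subst integral_add) (auto intro!: integrable_on_mult_right int0)
    also have "\<dots> \<le> 2 * Q + 2 * (U * (D * Q))"
      using U(2)[OF F, of c] N_le U(1) unfolding N_def
      by (smt (verit) mult_left_mono)
    finally have "(cmod a)\<^sup>2 \<le> (2 + 2 * U * D) / T * Q"
      using T by (simp add: field_simps)
    with N_le show ?thesis
      by (simp add: D'_def Q_def N_def distrib_right)
  qed
  show ?thesis
    unfolding ingham_lower_def
  proof (intro exI[of _ D'] conjI allI impI)
    show "0 < D'" using D U T by (simp add: D'_def add_pos_pos)
    fix F and c :: "real \<Rightarrow> complex" assume F: "finite F" "F \<subseteq> insert \<mu>0 \<Lambda>"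
    define a where "a = (if \<mu>0 \<in> F then c \<mu>0 else 0)"
    have "expsum F c t = expsum (F - {\<mu>0}) c t + a * cis (\<mu>0 * t)" for t
      using F by (auto simp: expsum_def a_def sum.remove add.commute)
    with F have "(\<Sum>\<mu>\<in>F - {\<mu>0}. (cmod (c \<mu>))\<^sup>2) + (cmod a)\<^sup>2 \<le> D' * integral {0..T} (\<lambda>t. (cmod (expsum F c t))\<^sup>2)"
      by (intro main) auto
    moreover have "(\<Sum>\<mu>\<in>F. (cmod (c \<mu>))\<^sup>2) = (\<Sum>\<mu>\<in>F - {\<mu>0}. (cmod (c \<mu>))\<^sup>2) + (cmod a)\<^sup>2"
      using F by (auto simp: a_def sum.remove add.commute)
    ultimately show "(\<Sum>\<mu>\<in>F. (cmod (c \<mu>))\<^sup>2) \<le> D' * integral {0..T} (\<lambda>t. (cmod (expsum F c t))\<^sup>2)" by simp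
  qed
qed

lemma ingham_lower_union_finite:
  assumes "finite A" "A \<inter> \<Lambda> = {}" "ingham_lower \<Lambda> S" "0 < S" "S < T" "0 < \<rho>" "separated \<rho> (A \<union> \<Lambda>)"
  shows "ingham_lower (A \<union> \<Lambda>) T"
proof -
  \<comment> \<open>The claim is kept for all T > S, so that each insertion can use half of the
    excess time and leave the other half to the earlier ones.\<close>
  have "\<forall>T>S. ingham_lower (insert x A \<union> \<Lambda>) T"
    if IH: "\<forall>T>S. ingham_lower (A \<union> \<Lambda>) T" and "x \<notin> A \<union> \<Lambda>" "separated \<rho> (insert x A \<union> \<Lambda>)" for x A
  proof (intro allI impI)
    fix T assume T: "S < T"
    have "ingham_lower (A \<union> \<Lambda>) ((S + T) / 2)" using IH T by simp
    then have "ingham_lower (insert x (A \<union> \<Lambda>)) T"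
      using that assms T by (intro ingham_lower_insert[where S = "(S + T) / 2" and \<rho> = \<rho>]) auto
    then show "ingham_lower (insert x A \<union> \<Lambda>) T" by simp
  qed
  note step = this
  have "\<forall>T>S. ingham_lower (A \<union> \<Lambda>) T"
    using assms(1,2,7)
  proof (induction A)
    case empty
    obtain C where C: "0 < C" "\<And>F c. finite F \<Longrightarrow> F \<subseteq> \<Lambda> \<Longrightarrow>
     (\<Sum>\<mu>\<in>F. (cmod (c \<mu>))\<^sup>2) \<le> C * integral {0..S} (\<lambda>t. (cmod (expsum F c t))\<^sup>2)"
      using assms(3) by (auto simp: ingham_lower_def)
    have "(\<Sum>\<mu>\<in>F. (cmod (c \<mu>))\<^sup>2) \<le> C * integral {0..T} (\<lambda>t. (cmod (expsum F c t))\<^sup>2)"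
      if "S < T" "finite F" "F \<subseteq> \<Lambda>" for T F c
    proof -
      have "integral {0..S} (\<lambda>t. (cmod (expsum F c t))\<^sup>2) \<le> integral {0..T} (\<lambda>t. (cmod (expsum F c t))\<^sup>2)"
        using that by (intro integral_subset_le) auto
      then show ?thesis
        using C(2)[of F c] that C(1) mult_left_mono[of _ _ C] by (meson less_imp_le order_trans)
    qed
    then show ?case using C(1) by (auto simp: ingham_lower_def)
  next
    case (insert x A)
    then show ?case
      by (intro step) (auto intro: separated_subset)
  qed
  then show ?thesis using assms(5) by blast
qed

text \<open>Frequencies outside \<open>A\<close> have mutual gaps above 28/T = 14/(T/2), enough for
  the interval of length T/2; the other half of T pays for putting \<open>A\<close> back. The
  insertions also need a positive gap for the whole set, which exists because pairs at distance at
  most 1 lie in the finite set \<open>P 1\<close>.\<close>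

lemma ingham_gaps_to_infinity:
  assumes near: "\<And>R. finite {\<mu>\<in>\<Lambda>. \<exists>\<nu>\<in>\<Lambda>. \<nu> \<noteq> \<mu> \<and> \<bar>\<mu> - \<nu>\<bar> \<le> R}" and T: "0 < T"
  shows "ingham_lower \<Lambda> T"
proof -
  define P where "P R = {\<mu>\<in>\<Lambda>. \<exists>\<nu>\<in>\<Lambda>. \<nu> \<noteq> \<mu> \<and> \<bar>\<mu> - \<nu>\<bar> \<le> R}" for R
  have fin: "finite (P R)" for R using near by (simp add: P_def)
  define \<rho> where "\<rho> = Min (insert 1 ((\<lambda>(x, y). \<bar>x - y\<bar>) ` {(x, y) \<in> P 1 \<times> P 1. x \<noteq> y}))"
  have fin2: "finite {(x, y) \<in> P 1 \<times> P 1. x \<noteq> y}"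
    by (rule finite_subset[of _ "P 1 \<times> P 1"]) (auto simp: fin)
  have \<rho>: "0 < \<rho>"
    unfolding \<rho>_def using fin2 by (subst Min_gr_iff) auto
  have sep: "separated \<rho> \<Lambda>"
    unfolding separated_def
  proof (intro ballI impI)
    fix x y assume xy: "x \<in> \<Lambda>" "y \<in> \<Lambda>" "x \<noteq> y"
    show "\<rho> \<le> \<bar>x - y\<bar>"
    proof (cases "\<bar>x - y\<bar> \<le> 1")
      case True
      with xy have "x \<in> P 1" "y \<in> P 1" by (auto simp: P_def abs_minus_commute)
      with xy have "\<bar>x - y\<bar> \<in> (\<lambda>(x, y). \<bar>x - y\<bar>) ` {(x, y) \<in> P 1 \<times> P 1. x \<noteq> y}" by force
      then show ?thesis unfolding \<rho>_def using fin2 by (intro Min_le) auto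
    next
      case False
      have "\<rho> \<le> 1" unfolding \<rho>_def using fin2 by (intro Min_le) auto
      with False show ?thesis by simp
    qed
  qed
  define A where "A = P (28 / T)"
  have "separated (28 / T) (\<Lambda> - A)"
    by (auto simp: separated_def A_def P_def)
  then have "ingham_lower (\<Lambda> - A) (T / 2)"
    using T by (intro ingham_lower_separated) auto
  moreover have "A \<union> (\<Lambda> - A) = \<Lambda>" by (auto simp: A_def P_def)
  ultimately show ?thesis
    using ingham_lower_union_finite[of A "\<Lambda> - A" "T / 2" T \<rho>] fin T \<rho> sep by (auto simp: A_def)
qed

section \<open>Completeness of the trigonometric system\<close>

definition trig_poly :: "(real \<Rightarrow> complex) \<Rightarrow> bool" where
  "trig_poly P \<longleftrightarrow> (\<exists>K b. finite K \<and> P = (\<lambda>x. \<Sum>k\<in>K. b k * cis (of_int k * x)))"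

text \<open>The map \<open>\<kappa>\<close> may repeat frequencies, so sums and products of
  trigonometric polynomials can be given unsimplified.\<close>

lemma trig_polyI:
  assumes "finite I" "\<And>x. P x = (\<Sum>i\<in>I. a i * cis (of_int (\<kappa> i) * x))"
  shows "trig_poly P"
  unfolding trig_poly_def
proof (intro exI conjI)
  show "finite (\<kappa> ` I)" using assms(1) by simp
  show "P = (\<lambda>x. \<Sum>k\<in>\<kappa> ` I. (\<Sum>i | i \<in> I \<and> \<kappa> i = k. a i) * cis (of_int k * x))"
    unfolding assms(2) sum_distrib_right
    by (subst sum.image_gen[OF assms(1), of _ \<kappa>]) (auto intro!: sum.cong)
qed

lemma trig_poly_add:
  assumes "trig_poly P" "trig_poly Q"
  shows "trig_poly (\<lambda>x. P x + Q x)"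
proof -
  obtain K b where K: "finite K" "P = (\<lambda>x. \<Sum>k\<in>K. b k * cis (of_int k * x))"
    using assms(1) unfolding trig_poly_def by blast
  obtain L c where L: "finite L" "Q = (\<lambda>x. \<Sum>k\<in>L. c k * cis (of_int k * x))"
    using assms(2) unfolding trig_poly_def by blast
  from K L show ?thesis
    by (intro trig_polyI[where I = "K <+> L" and a = "case_sum b c" and \<kappa> = "case_sum id id"])
      (auto simp: sum.Plus)
qed

lemma trig_poly_mult:
  assumes "trig_poly P" "trig_poly Q"
  shows "trig_poly (\<lambda>x. P x * Q x)"
proof -
  obtain K b where K: "finite K" "P = (\<lambda>x. \<Sum>k\<in>K. b k * cis (of_int k * x))"
    using assms(1) unfolding trig_poly_def by blast
  obtain L c where L: "finite L" "Q = (\<lambda>x. \<Sum>k\<in>L. c k * cis (of_int k * x))"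
    using assms(2) unfolding trig_poly_def by blast
  from K L show ?thesis
    by (intro trig_polyI[where I = "K \<times> L" and a = "\<lambda>(k, l). b k * c l" and \<kappa> = "\<lambda>(k, l). k + l"])
      (auto simp: sum_product sum.cartesian_product algebra_simps simp flip: cis_mult intro!: sum.cong)
qed

lemma trig_poly_const: "trig_poly (\<lambda>x. c)"
  by (intro trig_polyI[where I = "{0}" and a = "\<lambda>_. c" and \<kappa> = id]) auto

lemma trig_poly_cos: "trig_poly (\<lambda>x. of_real (cos x))"
  by (intro trig_polyI[where I = "{1, -1 :: int}" and a = "\<lambda>_. 1 / 2" and \<kappa> = id])
    (auto simp: complex_eq_iff)

lemma trig_poly_sin: "trig_poly (\<lambda>x. of_real (sin x))"
  by (intro trig_polyI[where I = "{1, -1 :: int}" and a = "\<lambda>k. of_int k / (2 * \<i>)" and \<kappa> = id])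
    (auto simp: complex_eq_iff)

lemma trig_poly_real_polynomial:
  fixes f :: "complex \<Rightarrow> real"
  assumes "real_polynomial_function f"
  shows "trig_poly (\<lambda>x. of_real (f (cis x)))"
  using assms
proof (induction f rule: real_polynomial_function.induct)
  case (linear f)
  interpret bounded_linear f by fact
  have "f (cis x) = cos x * f 1 + sin x * f \<i>" for x
  proof -
    have "cis x = cos x *\<^sub>R 1 + sin x *\<^sub>R \<i>" by (simp add: complex_eq_iff)
    then have "f (cis x) = f (cos x *\<^sub>R 1 + sin x *\<^sub>R \<i>)" by simp
    also have "\<dots> = cos x * f 1 + sin x * f \<i>" unfolding add scaleR by simp
    finally show ?thesis .
  qed
  then show ?case
    by (simp only: of_real_add of_real_mult)
      (intro trig_poly_add trig_poly_mult trig_poly_cos trig_poly_sin trig_poly_const)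
next
  case (const c)
  then show ?case by (rule trig_poly_const)
qed (simp_all add: trig_poly_add trig_poly_mult)

lemma trig_poly_polynomial:
  fixes g :: "complex \<Rightarrow> complex"
  assumes "polynomial_function g"
  shows "trig_poly (\<lambda>x. g (cis x))"
proof -
  have "real_polynomial_function (Re \<circ> g)" "real_polynomial_function (Im \<circ> g)"
    using assms bounded_linear_Re bounded_linear_Im unfolding polynomial_function_def by blast+
  then have "trig_poly (\<lambda>x. of_real (Re (g (cis x)))  + \<i> * of_real (Im (g (cis x))))"
    by (intro trig_poly_add trig_poly_mult trig_poly_const) (auto dest: trig_poly_real_polynomial)
  then show ?thesis by (simp flip: complex_eq)
qed

text \<open>\<open>cis\<close> maps the compact interval onto the circle and is therefore a quotient
  map; a function with equal end values factors through it. On the circle, Stone-Weierstrass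
  supplies a polynomial in the real coordinates, and its pullback along \<open>cis\<close> is a
  trigonometric polynomial.\<close>

lemma trig_poly_uniform_approx:
  assumes G: "continuous_on {0..2 * pi} G" "G 0 = G (2 * pi)" and "0 < e"
  obtains P where "trig_poly P" "\<And>x. x \<in> {0..2 * pi} \<Longrightarrow> cmod (G x - P x) < e"
proof -
  have img: "cis ` {0..2 * pi} = sphere 0 1"
  proof (intro equalityI subsetI)
    fix z :: complex assume "z \<in> sphere 0 1"
    then have "z = cis (Arg2pi z)"
      using Arg2pi_eq[of z] by (simp add: cis_conv_exp)
    moreover have "Arg2pi z \<in> {0..2 * pi}" using Arg2pi[of z] by auto
    ultimately show "z \<in> cis ` {0..2 * pi}" by blast
  qed auto
  have quot: "quotient_map (top_of_set {0..2 * pi}) (top_of_set (sphere 0 1)) cis"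
  proof (rule T1_Spaces.continuous_imp_quotient_map)
    show "continuous_map (top_of_set {0..2 * pi}) (top_of_set (sphere 0 1)) cis"
      using img by (auto intro!: continuous_intros)
  qed (use img in \<open>auto simp: compact_space_subtopology Hausdorff_space_subtopology\<close>)
  have cont: "continuous_map (top_of_set {0..2 * pi}) euclidean G" using G by simp
  have fib: "G x = G y" if xy: "x \<in> {0..2 * pi}" "y \<in> {0..2 * pi}" "cis x = cis y" for x y
  proof -
    have "x = y \<or> (x = 0 \<and> y = 2 * pi) \<or> (x = 2 * pi \<and> y = 0)"
    proof -
      obtain n :: int where n: "x = y + of_int n * (2 * pi)"
        using xy(3) unfolding cis_conv_exp exp_eq by (auto simp: complex_eq_iff algebra_simps)
      have "\<bar>x - y\<bar> \<le> 2 * pi" using xy by auto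
      then have "\<bar>of_int n * (2 * pi)\<bar> \<le> 1 * (2 * pi)" using n by simp
      then have "\<bar>n\<bar> \<le> 1" by (simp add: abs_mult)
      then have "n = 0 \<or> n = 1 \<or> n = -1" by linarith
      then show ?thesis using n xy by auto
    qed
    then show ?thesis using G(2) by auto
  qed
  obtain H where H: "continuous_map (top_of_set (sphere 0 1)) euclidean H"
    "\<And>x. x \<in> {0..2 * pi} \<Longrightarrow> H (cis x) = G x"
    using quotient_map_lift_exists[OF quot cont] fib by (metis topspace_euclidean_subtopology)
  have "continuous_on (sphere 0 1) H" using H(1) by simp
  from Stone_Weierstrass_polynomial_function[OF compact_sphere this \<open>0 < e\<close>]
  obtain g where g: "polynomial_function g" "\<And>z. z \<in> sphere 0 1 \<Longrightarrow> norm (H z - g z) < e"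
    by blast
  show ?thesis
  proof
    show "trig_poly (\<lambda>x. g (cis x))" using g(1) by (rule trig_poly_polynomial)
    show "cmod (G x - g (cis x)) < e" if "x \<in> {0..2 * pi}" for x
      using g(2)[of "cis x"] H(2)[OF that] by simp
  qed
qed

section \<open>Square-integrable functions, truncation and density\<close>

lemma L2_on_add:
  assumes "L2_on S f" "L2_on S g"
  shows "L2_on S (\<lambda>x. f x + g x)"
    and "(LINT x|lebesgue_on S. (cmod (f x + g x))\<^sup>2) \<le>
      2 * (LINT x|lebesgue_on S. (cmod (f x))\<^sup>2) + 2 * (LINT x|lebesgue_on S. (cmod (g x))\<^sup>2)"
proof -
  have [measurable]: "f \<in> borel_measurable (lebesgue_on S)" "g \<in> borel_measurable (lebesgue_on S)"
    using assms by (auto simp: L2_on_def)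
  have int: "integrable (lebesgue_on S) (\<lambda>x. 2 * (cmod (f x))\<^sup>2 + 2 * (cmod (g x))\<^sup>2)"
    using assms by (auto simp: L2_on_def)
  have int': "integrable (lebesgue_on S) (\<lambda>x. (cmod (f x + g x))\<^sup>2)"
    by (rule Bochner_Integration.integrable_bound[OF int]) (auto intro!: norm_add_sq_le)
  then show "L2_on S (\<lambda>x. f x + g x)" by (simp add: L2_on_def)
  have "(LINT x|lebesgue_on S. (cmod (f x + g x))\<^sup>2) \<le> (LINT x|lebesgue_on S. 2 * (cmod (f x))\<^sup>2 + 2 * (cmod (g x))\<^sup>2)"
    using int int' by (intro integral_mono norm_add_sq_le)
  also have "\<dots> = 2 * (LINT x|lebesgue_on S. (cmod (f x))\<^sup>2) + 2 * (LINT x|lebesgue_on S. (cmod (g x))\<^sup>2)"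
    using assms by (subst Bochner_Integration.integral_add) (auto simp: L2_on_def)
  finally show "(LINT x|lebesgue_on S. (cmod (f x + g x))\<^sup>2) \<le>
      2 * (LINT x|lebesgue_on S. (cmod (f x))\<^sup>2) + 2 * (LINT x|lebesgue_on S. (cmod (g x))\<^sup>2)" .
qed

lemma L2_on_uminus: "L2_on S f \<Longrightarrow> L2_on S (\<lambda>x. - f x)"
  by (auto simp: L2_on_def)

lemma L2_on_diff: "L2_on S f \<Longrightarrow> L2_on S g \<Longrightarrow> L2_on S (\<lambda>x. f x - g x)"
  using L2_on_add(1)[of S f "\<lambda>x. - g x"] L2_on_uminus[of S g] by simp

text \<open>A triangle inequality for squared norms; the factor 2 is paid to avoid square
  roots.\<close>

lemma L2_on_split:
  assumes "L2_on S (\<lambda>x. f x - g x)" "L2_on S (\<lambda>x. g x - h x)"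
  shows "(LINT x|lebesgue_on S. (cmod (f x - h x))\<^sup>2) \<le>
      2 * (LINT x|lebesgue_on S. (cmod (f x - g x))\<^sup>2) + 2 * (LINT x|lebesgue_on S. (cmod (g x - h x))\<^sup>2)"
  using L2_on_add(2)[OF assms] by simp

lemma L2_on_bounded:
  assumes "S \<in> lmeasurable" "f \<in> borel_measurable (lebesgue_on S)" "\<And>x. x \<in> S \<Longrightarrow> cmod (f x) \<le> R"
  shows "L2_on S f"
proof -
  interpret finite_measure "lebesgue_on S"
    using assms(1) by (rule finite_measure_lebesgue_on)
  have "integrable (lebesgue_on S) (\<lambda>x. (cmod (f x))\<^sup>2)"
    using assms by (intro integrable_const_bound[where B = "R\<^sup>2"])
      (auto intro!: AE_I2 power_mono simp: fmeasurableD)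
  then show ?thesis using assms(2) by (simp add: L2_on_def)
qed

lemma continuous_compact_bounded:
  fixes f :: "'a::topological_space \<Rightarrow> 'b::real_normed_vector"
  assumes "compact S" "continuous_on S f"
  obtains R where "\<And>x. x \<in> S \<Longrightarrow> norm (f x) \<le> R"
  using compact_imp_bounded[OF compact_continuous_image[OF assms(2,1)]] by (auto simp: bounded_iff)

lemma L2_on_continuous:
  assumes "compact S" "continuous_on S f"
  shows "L2_on S f"
proof -
  obtain R where "\<And>x. x \<in> S \<Longrightarrow> cmod (f x) \<le> R"
    using continuous_compact_bounded[OF assms] by blast
  then show ?thesis
    using assms by (intro L2_on_bounded continuous_imp_measurable_on_sets_lebesgue)
      (auto simp: lmeasurable_compact fmeasurableD)
qed

lemma integrable_continuous_lebesgue_on: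
  fixes f :: "real \<Rightarrow> 'b::euclidean_space"
  assumes "compact S" "continuous_on S f"
  shows "integrable (lebesgue_on S) f"
proof -
  interpret finite_measure "lebesgue_on S"
    using assms(1) by (intro finite_measure_lebesgue_on lmeasurable_compact)
  obtain R where "\<And>x. x \<in> S \<Longrightarrow> norm (f x) \<le> R"
    using continuous_compact_bounded[OF assms] by blast
  then show ?thesis
    using assms
    by (intro integrable_const_bound[where B = R] continuous_imp_measurable_on_sets_lebesgue AE_I2)
      (auto simp: lmeasurable_compact fmeasurableD)
qed

lemma continuous_on_trig_poly: "trig_poly P \<Longrightarrow> continuous_on A P"
  by (auto simp: trig_poly_def intro!: continuous_intros)

text \<open>The radial retraction of the plane onto the closed disc of radius R. Unlike a cutoff by
  zero it is continuous, so it commutes with limits and preserves continuity.\<close>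

definition trunc :: "real \<Rightarrow> complex \<Rightarrow> complex" where
  "trunc R z = z / of_real (max 1 (cmod z / R))"

lemma trunc_bound: "0 < R \<Longrightarrow> cmod (trunc R z) \<le> R"
  by (auto simp: trunc_def norm_divide max_def field_simps)

lemma trunc_eq: "0 < R \<Longrightarrow> cmod z \<le> R \<Longrightarrow> trunc R z = z"
  by (simp add: trunc_def max_def field_simps)

lemma trunc_diff: "cmod (z - trunc R z) \<le> cmod z"
proof -
  define m where "m = max 1 (cmod z / R)"
  have m: "1 \<le> m" by (simp add: m_def)
  then have "z - trunc R z = z * of_real (1 - 1 / m)"
    by (simp add: trunc_def m_def[symmetric] field_simps)
  then have "cmod (z - trunc R z) = cmod z * \<bar>1 - 1 / m\<bar>"
    by (simp only: norm_mult norm_of_real)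
  also have "\<dots> \<le> cmod z * 1" using m by (intro mult_left_mono) (auto simp: field_simps)
  finally show ?thesis by simp
qed

lemma continuous_on_trunc [continuous_intros]:
  assumes "0 < R" "continuous_on A f"
  shows "continuous_on A (\<lambda>x. trunc R (f x))"
  unfolding trunc_def using assms
  by (intro continuous_intros) (auto simp: max_def)

lemma trunc_L2_approx:
  assumes u: "L2_on S u" and "S \<in> lmeasurable" "0 < e"
  obtains R where "0 < R" "(LINT x|lebesgue_on S. (cmod (u x - trunc R (u x)))\<^sup>2) < e"
    "(\<lambda>x. trunc R (u x)) \<in> borel_measurable (lebesgue_on S)"
proof -
  have [measurable]: "u \<in> borel_measurable (lebesgue_on S)" using u by (simp add: L2_on_def)
  have [measurable]: "trunc R \<in> borel_measurable borel" if "0 < R" for R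
    using that by (intro borel_measurable_continuous_onI continuous_intros)
  have meas: "(\<lambda>x. trunc (real (Suc n)) (u x)) \<in> borel_measurable (lebesgue_on S)" for n
    by measurable
  have "(\<lambda>n. LINT x|lebesgue_on S. (cmod (u x - trunc (real (Suc n)) (u x)))\<^sup>2) \<longlonglongrightarrow> (LINT x|lebesgue_on S. 0)"
  proof (rule integral_dominated_convergence[where w = "\<lambda>x. (cmod (u x))\<^sup>2"])
    show "AE x in lebesgue_on S. (\<lambda>n. (cmod (u x - trunc (real (Suc n)) (u x)))\<^sup>2) \<longlonglongrightarrow> 0"
    proof (rule AE_I2, rule tendsto_eventually)
      fix x
      obtain N where N: "cmod (u x) \<le> real N" using real_arch_simple by blast
      show "\<forall>\<^sub>F n in sequentially. (cmod (u x - trunc (real (Suc n)) (u x)))\<^sup>2 = 0"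
        using eventually_ge_at_top[of N] by eventually_elim (use N in \<open>simp add: trunc_eq\<close>)
    qed
  qed (use u meas in \<open>auto simp: L2_on_def intro!: power_mono trunc_diff\<close>)
  then have "(\<lambda>n. LINT x|lebesgue_on S. (cmod (u x - trunc (real (Suc n)) (u x)))\<^sup>2) \<longlonglongrightarrow> 0" by simp
  then have "\<forall>\<^sub>F n in sequentially. (LINT x|lebesgue_on S. (cmod (u x - trunc (real (Suc n)) (u x)))\<^sup>2) < e"
    using \<open>0 < e\<close> by (rule order_tendstoD)
  then obtain n where "(LINT x|lebesgue_on S. (cmod (u x - trunc (real (Suc n)) (u x)))\<^sup>2) < e"
    by (auto simp: eventually_sequentially)
  then show ?thesis using that[of "real (Suc n)"] meas by simp
qed

text \<open>Measurability provides continuous functions converging to v almost everywhere, but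
  without any bound and without end conditions. Truncation at R gives a dominating constant and does
  not alter the limit; the cutoff \<open>\<phi>\<close> makes the functions vanish at both ends, so
  that they extend periodically.\<close>

lemma bounded_L2_approx_continuous:
  fixes a b :: real
  assumes v: "v \<in> borel_measurable (lebesgue_on {a..b})" "\<And>x. cmod (v x) \<le> R" and "0 < R" "a < b" "0 < e"
  obtains G where "continuous_on {a..b} G" "G a = 0" "G b = 0"
    "(LINT x|lebesgue_on {a..b}. (cmod (v x - G x))\<^sup>2) < e"
proof -
  obtain N g where N: "negligible N" and cont: "\<And>n. continuous_on UNIV (g n)"
    and lim: "\<And>x. x \<notin> N \<Longrightarrow> (\<lambda>n. g n x) \<longlonglongrightarrow> (if x \<in> {a..b} then v x else 0)"
  proof -
    have "v measurable_on {a..b}"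
      using v(1) measurable_on_iff_borel_measurable[of "{a..b}" v] by simp
    then show ?thesis using that unfolding measurable_on_def by blast
  qed
  define \<phi> where "\<phi> n x = min 1 (max 0 (real n * (x - a) * (b - x)))" for n x
  define G where "G n x = of_real (\<phi> n x) * trunc R (g n x)" for n x
  have contG: "continuous_on {a..b} (G n)" for n
    unfolding G_def \<phi>_def using \<open>0 < R\<close> continuous_on_subset[OF cont]
    by (intro continuous_intros) auto
  have \<phi>: "0 \<le> \<phi> n x" "\<phi> n x \<le> 1" for n x by (auto simp: \<phi>_def)
  have Gle: "cmod (G n x) \<le> R" for n x
  proof -
    have "cmod (G n x) \<le> 1 * R"
      unfolding G_def norm_mult using \<phi> \<open>0 < R\<close> by (intro mult_mono trunc_bound) auto
    then show ?thesis by simp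
  qed
  have meas: "G n \<in> borel_measurable (lebesgue_on {a..b})" for n
    by (intro continuous_imp_measurable_on_sets_lebesgue contG) auto
  interpret finite_measure "lebesgue_on {a..b}"
    by (rule finite_measure_lebesgue_on) simp
  have limG: "(\<lambda>n. G n x) \<longlonglongrightarrow> v x" if x: "x \<notin> N" "a < x" "x < b" for x
  proof -
    have "\<forall>\<^sub>F n in sequentially. \<phi> n x = 1"
    proof -
      obtain n0 where n0: "1 / ((x - a) * (b - x)) \<le> real n0" using real_arch_simple by blast
      have "\<phi> n x = 1" if "n0 \<le> n" for n
      proof -
        have "1 / ((x - a) * (b - x)) \<le> real n" using n0 that by linarith
        moreover have "0 < (x - a) * (b - x)" using x by simp
        ultimately have "1 \<le> real n * ((x - a) * (b - x))" by (simp only: pos_divide_le_eq)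
        then show ?thesis by (simp add: \<phi>_def mult.assoc)
      qed
      then show ?thesis by (auto simp: eventually_sequentially)
    qed
    then have "(\<lambda>n. of_real (\<phi> n x)) \<longlonglongrightarrow> (1 :: complex)"
      by (intro tendsto_eventually) (auto elim: eventually_mono)
    moreover have "(\<lambda>n. trunc R (g n x)) \<longlonglongrightarrow> trunc R (v x)"
    proof (rule isCont_tendsto_compose[where g = "trunc R"])
      show "isCont (trunc R) (v x)"
        using continuous_on_trunc[OF \<open>0 < R\<close> continuous_on_id, of UNIV] by (simp add: continuous_on_eq_continuous_at)
      show "(\<lambda>n. g n x) \<longlonglongrightarrow> v x" using lim[of x] x by simp
    qed
    ultimately have "(\<lambda>n. G n x) \<longlonglongrightarrow> 1 * trunc R (v x)"
      unfolding G_def by (intro tendsto_mult)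
    then show ?thesis using trunc_eq[OF \<open>0 < R\<close> v(2)] by simp
  qed
  have "(\<lambda>n. LINT x|lebesgue_on {a..b}. (cmod (v x - G n x))\<^sup>2) \<longlonglongrightarrow> (LINT x|lebesgue_on {a..b}. 0)"
  proof (rule integral_dominated_convergence[where w = "\<lambda>x. (2 * R)\<^sup>2"])
    have "negligible (N \<union> {a, b})" using N by (simp add: negligible_Un)
    then have "AE x in lebesgue. x \<notin> N \<union> {a, b}"
      by (intro AE_not_in) (simp add: negligible_iff_null_sets)
    then have "AE x in lebesgue. x \<in> {a..b} \<longrightarrow> (\<lambda>n. (cmod (v x - G n x))\<^sup>2) \<longlonglongrightarrow> 0"
    proof eventually_elim
      case (elim x)
      show ?case
      proof
        assume "x \<in> {a..b}"
        then have "(\<lambda>n. G n x) \<longlonglongrightarrow> v x" using elim by (intro limG) auto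
        then have "(\<lambda>n. (cmod (v x - G n x))\<^sup>2) \<longlonglongrightarrow> (cmod (v x - v x))\<^sup>2"
          by (intro tendsto_intros)
        then show "(\<lambda>n. (cmod (v x - G n x))\<^sup>2) \<longlonglongrightarrow> 0" by simp
      qed
    qed
    then show "AE x in lebesgue_on {a..b}. (\<lambda>n. (cmod (v x - G n x))\<^sup>2) \<longlonglongrightarrow> 0"
      by (subst AE_restrict_space_iff) auto
    show "AE x in lebesgue_on {a..b}. norm ((cmod (v x - G n x))\<^sup>2) \<le> (2 * R)\<^sup>2" for n
    proof (rule AE_I2)
      fix x
      have "cmod (v x - G n x) \<le> 2 * R"
        using norm_triangle_ineq4[of "v x" "G n x"] v(2)[of x] Gle[of n x] by linarith
      then have "(cmod (v x - G n x))\<^sup>2 \<le> (2 * R)\<^sup>2" by (intro power_mono) auto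
      then show "norm ((cmod (v x - G n x))\<^sup>2) \<le> (2 * R)\<^sup>2" by simp
    qed
    show "(\<lambda>x. (cmod (v x - G n x))\<^sup>2) \<in> borel_measurable (lebesgue_on {a..b})" for n
      using v(1) meas[of n] by measurable
  qed auto
  then have "(\<lambda>n. LINT x|lebesgue_on {a..b}. (cmod (v x - G n x))\<^sup>2) \<longlonglongrightarrow> 0" by simp
  then have "\<forall>\<^sub>F n in sequentially. (LINT x|lebesgue_on {a..b}. (cmod (v x - G n x))\<^sup>2) < e"
    using \<open>0 < e\<close> by (rule order_tendstoD)
  then obtain n where "(LINT x|lebesgue_on {a..b}. (cmod (v x - G n x))\<^sup>2) < e"
    by (auto simp: eventually_sequentially)
  moreover have "G n a = 0" "G n b = 0" by (simp_all add: G_def \<phi>_def)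
  ultimately show ?thesis using contG that by blast
qed

text \<open>Error budget: a uniform error of sqrt(e/64) on an interval of length below 8 costs at
  most e/8. Then 2(e/16) + 2(e/8) = 3e/8 for the truncated function and 2(e/8) + 2(3e/8) = e for
  u.\<close>

lemma trig_poly_L2_approx:
  assumes u: "L2_on {0..2 * pi} u" and "0 < e"
  obtains P where "trig_poly P" "(LINT x|lebesgue_on {0..2 * pi}. (cmod (u x - P x))\<^sup>2) \<le> e"
proof -
  let ?I = "{0..2 * pi}"
  obtain R where R: "0 < R" "(LINT x|lebesgue_on ?I. (cmod (u x - trunc R (u x)))\<^sup>2) < e / 8"
    "(\<lambda>x. trunc R (u x)) \<in> borel_measurable (lebesgue_on ?I)"
    using trunc_L2_approx[OF u, of "e / 8"] \<open>0 < e\<close> by auto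
  define v where "v x = trunc R (u x)" for x
  have v_le: "cmod (v x) \<le> R" for x using R(1) by (simp add: v_def trunc_bound)
  have v_meas: "v \<in> borel_measurable (lebesgue_on ?I)" using R(3) by (simp add: v_def[abs_def])
  have v: "L2_on ?I v" using v_meas v_le by (intro L2_on_bounded) auto
  obtain G where G: "continuous_on ?I G" "G 0 = 0" "G (2 * pi) = 0"
    "(LINT x|lebesgue_on ?I. (cmod (v x - G x))\<^sup>2) < e / 16"
    using bounded_L2_approx_continuous[OF v_meas v_le R(1), of "e / 16"] \<open>0 < e\<close> by auto
  obtain P where P: "trig_poly P" "\<And>x. x \<in> ?I \<Longrightarrow> cmod (G x - P x) < sqrt (e / 64)"
    using trig_poly_uniform_approx[of G "sqrt (e / 64)"] G \<open>0 < e\<close> by auto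
  have LG: "L2_on ?I G" and LP: "L2_on ?I P"
    using G P(1) by (auto intro!: L2_on_continuous continuous_on_trig_poly)
  have "(LINT x|lebesgue_on ?I. (cmod (G x - P x))\<^sup>2) \<le> (LINT x|lebesgue_on ?I. e / 64)"
  proof (rule integral_mono)
    show "integrable (lebesgue_on ?I) (\<lambda>x. (cmod (G x - P x))\<^sup>2)"
      using L2_on_diff[OF LG LP] by (simp add: L2_on_def)
    show "integrable (lebesgue_on ?I) (\<lambda>x. e / 64)"
      by (intro integrable_continuous_lebesgue_on) auto
    fix x assume "x \<in> space (lebesgue_on ?I)"
    then have "(cmod (G x - P x))\<^sup>2 \<le> (sqrt (e / 64))\<^sup>2"
      using P(2)[of x] by (intro power_mono) auto
    then show "(cmod (G x - P x))\<^sup>2 \<le> e / 64" using \<open>0 < e\<close> by simp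
  qed
  also have "\<dots> = 2 * pi * (e / 64)"
    by (simp add: measure_restrict_space)
  also have "\<dots> \<le> 8 * (e / 64)"
    using pi_less_4 \<open>0 < e\<close> by (intro mult_right_mono) auto
  finally have GP: "(LINT x|lebesgue_on ?I. (cmod (G x - P x))\<^sup>2) \<le> e / 8" by simp
  have "(LINT x|lebesgue_on ?I. (cmod (v x - P x))\<^sup>2) \<le> 3 * e / 8"
    using L2_on_split[OF L2_on_diff[OF v LG] L2_on_diff[OF LG LP]] G(4) GP by linarith
  then have "(LINT x|lebesgue_on ?I. (cmod (u x - P x))\<^sup>2) \<le> e"
    using L2_on_split[OF L2_on_diff[OF u v] L2_on_diff[OF v LP]] R(2) unfolding v_def by linarith
  then show ?thesis using P(1) that by blast
qed

section \<open>Orthogonality, and the norm bounded by the Fourier coefficients\<close>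

lemma integral_cis_period:
  "(LINT x|lebesgue_on {0..2 * pi}. cis (of_int k * x)) = (if k = 0 then 2 * pi else 0)"
proof (cases "k = 0")
  case True
  then show ?thesis by (simp add: measure_restrict_space scaleR_conv_of_real)
next
  case False
  define G where "G z = exp (\<i> * (of_int k * z)) / (\<i> * of_int k)" for z :: complex
  have dG: "(G has_field_derivative exp (\<i> * (of_int k * z))) (at z)" for z
    unfolding G_def using False by (auto intro!: derivative_eq_intros simp: field_simps)
  have "((\<lambda>t. G (of_real t)) has_vector_derivative cis (of_int k * t)) (at t within {0..2 * pi})" for t
    using has_vector_derivative_real_field[OF dG, of t "{0..2 * pi}"]
    by (simp add: cis_conv_exp)
  from fundamental_theorem_of_calculus[OF _ this]
  have "((\<lambda>t. cis (of_int k * t)) has_integral G (of_real (2 * pi)) - G (of_real 0)) {0..2 * pi}" by simp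
  moreover have "G (of_real (2 * pi)) = G (of_real 0)"
  proof -
    have "exp (\<i> * (of_int k * of_real (2 * pi))) = cis (2 * pi * of_int k)"
      by (simp add: cis_conv_exp mult_ac)
    also have "\<dots> = 1" by (rule cis_multiple_2pi) simp
    finally show ?thesis by (simp add: G_def)
  qed
  ultimately have "integral {0..2 * pi} (\<lambda>t. cis (of_int k * t)) = 0" by (simp add: integral_unique)
  then show ?thesis using False
    by (subst lebesgue_integral_eq_integral)
      (auto intro!: integrable_continuous_lebesgue_on continuous_intros)
qed

lemma integrable_L2_mult_continuous:
  assumes u: "L2_on {0..2 * pi} u" and g: "continuous_on {0..2 * pi} g"
  shows "integrable (lebesgue_on {0..2 * pi}) (\<lambda>x. u x * g x :: complex)"
proof -
  let ?I = "{0..2 * pi}"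
  have [measurable]: "u \<in> borel_measurable (lebesgue_on ?I)" using u by (simp add: L2_on_def)
  have [measurable]: "g \<in> borel_measurable (lebesgue_on ?I)"
    using g by (intro continuous_imp_measurable_on_sets_lebesgue) auto
  have "integrable (lebesgue_on ?I) (\<lambda>x. (cmod (u x))\<^sup>2 + (cmod (g x))\<^sup>2)"
    using u L2_on_continuous[OF _ g] by (auto simp: L2_on_def)
  then show ?thesis
  proof (rule Bochner_Integration.integrable_bound)
    show "AE x in lebesgue_on ?I. norm (u x * g x) \<le> norm ((cmod (u x))\<^sup>2 + (cmod (g x))\<^sup>2)"
    proof (rule AE_I2)
      fix x
      have "norm (u x * g x) \<le> 2 * cmod (u x) * cmod (g x)" by (simp add: norm_mult)
      also have "\<dots> \<le> (cmod (u x))\<^sup>2 + (cmod (g x))\<^sup>2" by (rule sum_squares_bound)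
      finally show "norm (u x * g x) \<le> norm ((cmod (u x))\<^sup>2 + (cmod (g x))\<^sup>2)" by simp
    qed
  qed measurable
qed

lemma fourier_coeff_trig_sum:
  assumes "finite K"
  shows "fourier_coeff (\<lambda>x. \<Sum>j\<in>K. b j * cis (of_int j * x)) k = (if k \<in> K then b k else 0)"
proof -
  let ?M = "lebesgue_on {0..2 * pi}"
  have "(LINT x|?M. (\<Sum>j\<in>K. b j * cis (of_int j * x)) * cis (- (of_int k * x))) =
    (LINT x|?M. (\<Sum>j\<in>K. b j * cis (of_int (j - k) * x)))"
    unfolding sum_distrib_right mult.assoc cis_mult by (simp add: algebra_simps)
  also have "\<dots> = (\<Sum>j\<in>K. b j * (LINT x|?M. cis (of_int (j - k) * x)))"
    by (subst Bochner_Integration.integral_sum)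
      (auto intro!: integrable_continuous_lebesgue_on continuous_intros)
  also have "\<dots> = (\<Sum>j\<in>K. if j = k then 2 * pi * b k else 0)"
    unfolding integral_cis_period by (intro sum.cong) auto
  also have "\<dots> = (if k \<in> K then 2 * pi * b k else 0)"
    using assms by simp
  finally show ?thesis by (simp add: fourier_coeff_def scaleR_conv_of_real)
qed

text \<open>The error of the approximation by \<open>P\<close> exceeds \<open>\<parallel>u\<parallel>\<^sup>2 - 2\<pi> \<Sum>\<bar>c\<^sub>k\<bar>\<^sup>2\<close> by \<open>2\<pi> \<Sum>\<bar>b\<^sub>k - c\<^sub>k\<bar>\<^sup>2\<close>.\<close>

lemma L2_le_trig_error_plus_fourier:
  assumes u: "L2_on {0..2 * pi} u" and K: "finite K"
    and P: "\<And>x. P x = (\<Sum>k\<in>K. b k * cis (of_int k * x))"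
  shows "(LINT x|lebesgue_on {0..2 * pi}. (cmod (u x))\<^sup>2) \<le>
    (LINT x|lebesgue_on {0..2 * pi}. (cmod (u x - P x))\<^sup>2) + 2 * pi * (\<Sum>k\<in>K. (cmod (fourier_coeff u k))\<^sup>2)"
proof -
  let ?M = "lebesgue_on {0..2 * pi}"
  define c where "c = fourier_coeff u"
  have contP: "continuous_on A P" for A unfolding P by (intro continuous_intros)
  have int_uP: "integrable ?M (\<lambda>x. u x * cnj (P x))"
    by (intro integrable_L2_mult_continuous u continuous_intros contP)
  have int_PP: "integrable ?M (\<lambda>x. P x * cnj (P x))"
    by (intro integrable_continuous_lebesgue_on continuous_intros contP) auto
  have int_cis: "integrable ?M (\<lambda>x. u x * cis (- (of_int k * x)))" for k
    by (intro integrable_L2_mult_continuous u continuous_intros)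
  have c: "(LINT x|?M. u x * cis (- (of_int k * x))) = 2 * pi * c k" for k
    by (simp add: c_def fourier_coeff_def scaleR_conv_of_real)
  have uP: "(LINT x|?M. u x * cnj (P x)) = 2 * pi * (\<Sum>k\<in>K. cnj (b k) * c k)"
  proof -
    have "(LINT x|?M. u x * cnj (P x)) = (LINT x|?M. (\<Sum>k\<in>K. cnj (b k) * (u x * cis (- (of_int k * x)))))"
      unfolding P by (simp add: sum_distrib_left cis_cnj mult_ac)
    also have "\<dots> = (\<Sum>k\<in>K. cnj (b k) * (LINT x|?M. u x * cis (- (of_int k * x))))"
      by (subst Bochner_Integration.integral_sum) (auto intro!: int_cis)
    also have "\<dots> = 2 * pi * (\<Sum>k\<in>K. cnj (b k) * c k)"
      unfolding c by (simp add: sum_distrib_left mult_ac)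
    finally show ?thesis .
  qed
  have PP: "(LINT x|?M. P x * cnj (P x)) = 2 * pi * (\<Sum>k\<in>K. cnj (b k) * b k)"
  proof -
    have L2P: "L2_on {0..2 * pi} P" by (intro L2_on_continuous contP) auto
    have cP: "(LINT x|?M. P x * cis (- (of_int k * x))) = 2 * pi * b k" if "k \<in> K" for k
      using fourier_coeff_trig_sum[OF K, of b k] that
      by (simp add: P[abs_def] fourier_coeff_def scaleR_conv_of_real field_simps)
    have int_P: "integrable ?M (\<lambda>x. P x * cis (- (of_int k * x)))" for k
      by (intro integrable_L2_mult_continuous L2P continuous_intros)
    have "(LINT x|?M. P x * cnj (P x)) = (LINT x|?M. (\<Sum>k\<in>K. cnj (b k) * (P x * cis (- (of_int k * x)))))"
      by (subst (2) P) (simp add: sum_distrib_left cis_cnj mult_ac)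
    also have "\<dots> = (\<Sum>k\<in>K. cnj (b k) * (LINT x|?M. P x * cis (- (of_int k * x))))"
      by (subst Bochner_Integration.integral_sum) (auto intro!: int_P)
    also have "\<dots> = 2 * pi * (\<Sum>k\<in>K. cnj (b k) * b k)"
      using cP by (simp add: sum_distrib_left mult_ac)
    finally show ?thesis .
  qed
  have int_u: "integrable ?M (\<lambda>x. complex_of_real ((cmod (u x))\<^sup>2))"
    by (rule integrable_of_real) (use u in \<open>simp add: L2_on_def\<close>)
  have pt: "complex_of_real ((cmod (u x - P x))\<^sup>2) =
      of_real ((cmod (u x))\<^sup>2) - u x * cnj (P x) - cnj (u x * cnj (P x)) + P x * cnj (P x)" for x
    unfolding complex_norm_square by (simp add: algebra_simps)
  have "complex_of_real (LINT x|?M. (cmod (u x - P x))\<^sup>2) = (LINT x|?M. complex_of_real ((cmod (u x - P x))\<^sup>2))"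
    by (rule integral_complex_of_real[symmetric])
  also have "\<dots> = of_real (LINT x|?M. (cmod (u x))\<^sup>2) - (LINT x|?M. u x * cnj (P x)) -
      cnj (LINT x|?M. u x * cnj (P x)) + (LINT x|?M. P x * cnj (P x))"
    unfolding pt using int_u int_uP int_PP
    by (simp only: Bochner_Integration.integral_add Bochner_Integration.integral_diff
        Bochner_Integration.integrable_diff integrable_cnj Bochner_Integration.integral_cnj integral_complex_of_real)
  also have "\<dots> = of_real (LINT x|?M. (cmod (u x))\<^sup>2) + of_real (2 * pi) *
      (\<Sum>k\<in>K. of_real ((cmod (b k - c k))\<^sup>2) - of_real ((cmod (c k))\<^sup>2))"
    unfolding uP PP complex_norm_square
    by (simp add: sum_distrib_left sum_subtractf sum.distrib algebra_simps)
  also have "\<dots> = of_real ((LINT x|?M. (cmod (u x))\<^sup>2) + 2 * pi *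
      (\<Sum>k\<in>K. (cmod (b k - c k))\<^sup>2 - (cmod (c k))\<^sup>2))"
    by simp
  finally have "(LINT x|?M. (cmod (u x - P x))\<^sup>2) = (LINT x|?M. (cmod (u x))\<^sup>2) + 2 * pi *
      (\<Sum>k\<in>K. (cmod (b k - c k))\<^sup>2 - (cmod (c k))\<^sup>2)"
    by (simp only: of_real_eq_iff)
  moreover have "0 \<le> 2 * pi * (\<Sum>k\<in>K. (cmod (b k - c k))\<^sup>2)"
    by (intro mult_nonneg_nonneg sum_nonneg) auto
  ultimately show ?thesis
    by (simp add: c_def sum_subtractf right_diff_distrib)
qed

lemma finite_int_subset_symmetric:
  fixes K :: "int set"
  assumes "finite K"
  shows "\<exists>N0. \<forall>N\<ge>N0. K \<subseteq> {- int N..int N}"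
proof -
  define N0 where "N0 = nat (Max (abs ` insert 0 K))"
  have "K \<subseteq> {- int N..int N}" if "N0 \<le> N" for N
  proof
    fix k assume "k \<in> K"
    then have "\<bar>k\<bar> \<le> Max (abs ` insert 0 K)" using assms by (intro Max_ge) auto
    then have "\<bar>k\<bar> \<le> int N0" unfolding N0_def by linarith
    then show "k \<in> {- int N..int N}" using that by auto
  qed
  then show ?thesis by blast
qed

text \<open>The converse of Bessel's inequality: the approximation error of a trigonometric
  polynomial is arbitrarily small, and its finitely many frequencies lie in some symmetric
  range.\<close>

lemma L2_le_fourier_bound:
  assumes u: "L2_on {0..2 * pi} u"
    and B: "\<And>N. (\<Sum>k\<in>{- int N..int N}. (cmod (fourier_coeff u k))\<^sup>2) \<le> B"
  shows "(LINT x|lebesgue_on {0..2 * pi}. (cmod (u x))\<^sup>2) \<le> 2 * pi * B"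
proof (rule field_le_epsilon)
  fix e :: real assume "0 < e"
  obtain P where P: "trig_poly P" "(LINT x|lebesgue_on {0..2 * pi}. (cmod (u x - P x))\<^sup>2) \<le> e"
    using trig_poly_L2_approx[OF u \<open>0 < e\<close>] by blast
  obtain K b where K: "finite K" "\<And>x. P x = (\<Sum>k\<in>K. b k * cis (of_int k * x))"
    using P(1) unfolding trig_poly_def by blast
  obtain N where "K \<subseteq> {- int N..int N}"
    using finite_int_subset_symmetric[OF K(1)] by auto
  then have "(\<Sum>k\<in>K. (cmod (fourier_coeff u k))\<^sup>2) \<le> (\<Sum>k\<in>{- int N..int N}. (cmod (fourier_coeff u k))\<^sup>2)"
    by (intro sum_mono2) auto
  also have "\<dots> \<le> B" by (rule B)
  finally have "2 * pi * (\<Sum>k\<in>K. (cmod (fourier_coeff u k))\<^sup>2) \<le> 2 * pi * B"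
    by (intro mult_left_mono) auto
  then show "(LINT x|lebesgue_on {0..2 * pi}. (cmod (u x))\<^sup>2) \<le> 2 * pi * B + e"
    using L2_le_trig_error_plus_fourier[OF u K] P(2) by linarith
qed

section \<open>Observability\<close>

lemma expsum_group:
  assumes "finite K"
  shows "(\<Sum>k\<in>K. b k * cis (\<kappa> k * t)) = expsum (\<kappa> ` K) (\<lambda>\<mu>. \<Sum>k | k \<in> K \<and> \<kappa> k = \<mu>. b k) t"
  unfolding expsum_def sum_distrib_right
  by (subst sum.image_gen[OF assms, of _ \<kappa>]) (auto intro!: sum.cong)

text \<open>With \<open>A v + B = x\<^sub>0 + v t\<^sub>0\<close> one has
  \<open>p(k) t\<^sub>0 + k x\<^sub>0 = A p(k) + B k + (t\<^sub>0 - A) \<lambda>\<^sub>k(v)\<close>. Two lines of different speeds share such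
  \<open>(A, B)\<close>, namely the point where they intersect, so the phases can be gauged away on both at once.\<close>

lemma fourier_partial_sum_expsum:
  assumes sol: "is_solution p u0 u" and gauge: "A * v + B = x0 + v * t0"
  shows "fourier_partial_sum N (u (t0 + t)) (x0 - v * t) =
    expsum (lam p v ` {- int N..int N}) (\<lambda>\<mu>. cis ((t0 - A) * \<mu>) *
      (\<Sum>k | k \<in> {- int N..int N} \<and> lam p v k = \<mu>. fourier_coeff u0 k * cis (A * poly p (of_int k) + B * of_int k))) t"
proof -
  have phase: "poly p (of_int k) * t0 + of_int k * x0 =
      (t0 - A) * lam p v k + (A * poly p (of_int k) + B * of_int k)" for k
  proof -
    have "of_int k * (A * v + B) = of_int k * (x0 + v * t0)" using gauge by simp
    then show ?thesis by (simp add: lam_def algebra_simps)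
  qed
  show ?thesis
    unfolding fourier_partial_sum_on_line[OF sol] phase
    by (subst expsum_group)
      (auto simp: sum_distrib_left expsum_def cis_mult[symmetric] mult_ac intro!: sum.cong)
qed

text \<open>For gauged coefficients \<open>d\<close> this is the sum of the squared coefficients of
  the solution's partial sum on a line of speed v: there the class sums appear multiplied by phases
  of modulus 1.\<close>

definition class_energy :: "real poly \<Rightarrow> real \<Rightarrow> int set \<Rightarrow> (int \<Rightarrow> complex) \<Rightarrow> real" where
  "class_energy p v K d = (\<Sum>\<mu>\<in>lam p v ` K. (cmod (\<Sum>k | k \<in> K \<and> lam p v k = \<mu>. d k))\<^sup>2)"

lemma class_energy_nonneg: "0 \<le> class_energy p v K d"
  by (simp add: class_energy_def sum_nonneg)

lemma class_sum_le_energy: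
  assumes "finite K"
  shows "(cmod (\<Sum>k | k \<in> K \<and> lam p v k = \<mu>. d k))\<^sup>2 \<le> class_energy p v K d"
proof (cases "\<mu> \<in> lam p v ` K")
  case True
  then show ?thesis
    unfolding class_energy_def using assms
    by (intro member_le_sum[where f = "\<lambda>\<mu>. (cmod (\<Sum>k | k \<in> K \<and> lam p v k = \<mu>. d k))\<^sup>2"]) auto
next
  case False
  then have empty: "{k. k \<in> K \<and> lam p v k = \<mu>} = {}" by auto
  show ?thesis unfolding empty by (simp add: class_energy_nonneg)
qed

lemma class_sum_outside_Pi_set:
  assumes "k \<in> K" "k \<notin> Pi_set p v"
  shows "(\<Sum>m | m \<in> K \<and> lam p v m = lam p v k. d m) = d k"
proof -
  have "{m. m \<in> K \<and> lam p v m = lam p v k} = {k}"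
    using assms by (auto simp: Pi_set_def)
  then show ?thesis by simp
qed

lemma energy_outside_Pi_set:
  assumes "finite K"
  shows "(\<Sum>k\<in>K - Pi_set p v. (cmod (d k))\<^sup>2) \<le> class_energy p v K d"
proof -
  have inj: "inj_on (lam p v) (K - Pi_set p v)"
    by (auto simp: inj_on_def Pi_set_def)
  have "(\<Sum>k\<in>K - Pi_set p v. (cmod (d k))\<^sup>2) =
      (\<Sum>k\<in>K - Pi_set p v. (cmod (\<Sum>m | m \<in> K \<and> lam p v m = lam p v k. d m))\<^sup>2)"
    by (intro sum.cong refl) (simp add: class_sum_outside_Pi_set)
  also have "\<dots> = (\<Sum>\<mu>\<in>lam p v ` (K - Pi_set p v). (cmod (\<Sum>m | m \<in> K \<and> lam p v m = \<mu>. d m))\<^sup>2)"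
    by (simp add: sum.reindex[OF inj])
  also have "\<dots> \<le> class_energy p v K d"
    unfolding class_energy_def using assms by (intro sum_mono2) auto
  finally show ?thesis .
qed

text \<open>An index outside one of the two sets \<open>Pi_set\<close> is alone in its class for
  that speed, so its coefficient is a class sum and is controlled by the energy. Only the finite
  intersection remains, and peeling bounds it with M = sqrt E.\<close>

lemma energy_le_class_energies:
  assumes deg: "2 < degree p" and v: "v1 \<noteq> v2" and nc: "\<not> has_two_colored_cycle p v1 v2"
  obtains C where "0 < C" "\<And>K d. finite K \<Longrightarrow>
    (\<Sum>k\<in>K. (cmod (d k))\<^sup>2) \<le> C * (class_energy p v1 K d + class_energy p v2 K d)"
proof -
  define I where "I = Pi_set p v1 \<inter> Pi_set p v2"
  have fin: "finite I" unfolding I_def using finite_Pi_set_Int[OF deg v] .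
  obtain C0 where C0: "1 \<le> C0"
    and C0_bound: "\<forall>K (d :: int \<Rightarrow> complex) M. finite K \<longrightarrow> (\<forall>k. k \<notin> K \<longrightarrow> d k = 0) \<longrightarrow>
    (\<forall>k. \<forall>v\<in>{v1, v2}. cmod (\<Sum>m | m \<in> K \<and> lam p v m = lam p v k. d m) \<le> M) \<longrightarrow>
    (\<forall>m. m \<notin> I \<longrightarrow> cmod (d m) \<le> M) \<longrightarrow> (\<forall>k. cmod (d k) \<le> C0 * M)"
    using peeling[OF v nc finite_lam_fiber[OF deg] fin] by (elim exE conjE) (rule that)
  \<comment> \<open>The first summand pays for the indices in \<open>I\<close>, the 1 for all
    others.\<close>
  define C where "C = real (card I) * C0\<^sup>2 + 1"
  have bound: "(\<Sum>k\<in>K. (cmod (d k))\<^sup>2) \<le> C * (class_energy p v1 K d + class_energy p v2 K d)"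
    if K: "finite K" and d: "\<And>k. k \<notin> K \<Longrightarrow> d k = 0" for K d
  proof -
    define E where "E = class_energy p v1 K d + class_energy p v2 K d"
    have E0: "0 \<le> E" by (simp add: E_def class_energy_nonneg)
    have S: "cmod (\<Sum>m | m \<in> K \<and> lam p v m = \<mu>. d m) \<le> sqrt E" if "v \<in> {v1, v2}" for v \<mu>
    proof (rule real_le_rsqrt)
      have "(cmod (\<Sum>m | m \<in> K \<and> lam p v m = \<mu>. d m))\<^sup>2 \<le> class_energy p v K d"
        using K by (rule class_sum_le_energy)
      also have "\<dots> \<le> E" using that class_energy_nonneg[of p] by (auto simp: E_def)
      finally show "(cmod (\<Sum>m | m \<in> K \<and> lam p v m = \<mu>. d m))\<^sup>2 \<le> E" .
    qed
    have out: "cmod (d m) \<le> sqrt E" if m: "m \<notin> I" for m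
    proof (cases "m \<in> K")
      case True
      obtain v where v: "v \<in> {v1, v2}" "m \<notin> Pi_set p v" using m by (auto simp: I_def)
      then show ?thesis using S[OF v(1), of "lam p v m"] class_sum_outside_Pi_set[OF True v(2), of d] by simp
    next
      case False
      then show ?thesis using d E0 by simp
    qed
    have "cmod (d k) \<le> C0 * sqrt E" for k
      by (rule C0_bound[rule_format, OF K]) (simp_all add: d S out)
    then have dk: "(cmod (d k))\<^sup>2 \<le> C0\<^sup>2 * E" for k
      using power_mono[of "cmod (d k)" "C0 * sqrt E" 2] E0 by (simp add: power_mult_distrib)
    have "(\<Sum>k\<in>K. (cmod (d k))\<^sup>2) = (\<Sum>k\<in>K \<inter> I. (cmod (d k))\<^sup>2) + (\<Sum>k\<in>K - I. (cmod (d k))\<^sup>2)"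
      using K by (metis sum.Int_Diff)
    also have "(\<Sum>k\<in>K \<inter> I. (cmod (d k))\<^sup>2) \<le> real (card (K \<inter> I)) * (C0\<^sup>2 * E)"
      by (intro sum_bounded_above dk)
    also have "real (card (K \<inter> I)) * (C0\<^sup>2 * E) \<le> real (card I) * (C0\<^sup>2 * E)"
      using fin E0 by (intro mult_right_mono of_nat_mono card_mono) auto
    also have "(\<Sum>k\<in>K - I. (cmod (d k))\<^sup>2) \<le> (\<Sum>k\<in>(K - Pi_set p v1) \<union> (K - Pi_set p v2). (cmod (d k))\<^sup>2)"
      using K by (intro sum_mono2) (auto simp: I_def)
    also have "\<dots> \<le> (\<Sum>k\<in>K - Pi_set p v1. (cmod (d k))\<^sup>2) + (\<Sum>k\<in>K - Pi_set p v2. (cmod (d k))\<^sup>2)"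
      using K by (subst sum.union_inter[symmetric]) (auto intro: sum_nonneg)
    also have "\<dots> \<le> E"
      unfolding E_def using K by (intro add_mono energy_outside_Pi_set)
    finally show ?thesis by (simp add: C_def E_def algebra_simps)
  qed
  have "(\<Sum>k\<in>K. (cmod (d k))\<^sup>2) \<le> C * (class_energy p v1 K d + class_energy p v2 K d)"
    if "finite K" for K d
  proof -
    \<comment> \<open>Peeling asks for coefficients that vanish outside K; cutting d off there
      changes no class sum over K.\<close>
    have "(\<Sum>k | k \<in> K \<and> lam p v k = \<mu>. if k \<in> K then d k else 0) = (\<Sum>k | k \<in> K \<and> lam p v k = \<mu>. d k)" for v \<mu>
      by (intro sum.cong) auto
    then show ?thesis
      using bound[OF that, of "\<lambda>k. if k \<in> K then d k else 0"] by (simp add: class_energy_def)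
  qed
  moreover have "0 < C" by (simp add: C_def add_nonneg_pos)
  ultimately show ?thesis using that by blast
qed

section \<open>From the two lines to the quantitative estimate\<close>

lemma ingham_lower_lam:
  assumes "2 < degree p" "0 < T"
  shows "ingham_lower (range (lam p v)) T"
proof (rule ingham_gaps_to_infinity[OF _ assms(2)])
  fix R
  have "{\<mu> \<in> range (lam p v). \<exists>\<nu>\<in>range (lam p v). \<nu> \<noteq> \<mu> \<and> \<bar>\<mu> - \<nu>\<bar> \<le> R} \<subseteq>
      lam p v ` {k. \<exists>m. lam p v k \<noteq> lam p v m \<and> \<bar>lam p v k - lam p v m\<bar> \<le> R}" (is "?L \<subseteq> lam p v ` ?K")
  proof
    fix \<mu> assume "\<mu> \<in> ?L"
    then obtain k m where "\<mu> = lam p v k" "lam p v m \<noteq> \<mu>" "\<bar>\<mu> - lam p v m\<bar> \<le> R" by blast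
    then have "k \<in> ?K" by (intro CollectI exI[of _ m]) auto
    with \<open>\<mu> = lam p v k\<close> show "\<mu> \<in> lam p v ` ?K" by (rule image_eqI)
  qed
  then show "finite {\<mu> \<in> range (lam p v). \<exists>\<nu>\<in>range (lam p v). \<nu> \<noteq> \<mu> \<and> \<bar>\<mu> - \<nu>\<bar> \<le> R}"
    using finite_lam_near[OF assms(1)] by (rule finite_subset[OF _ finite_imageI])
qed

lemma L2_on_expsum:
  shows "L2_on {0<..<T} (expsum F c)"
    and "(LINT t|lebesgue_on {0<..<T}. (cmod (expsum F c t))\<^sup>2) = integral {0..T} (\<lambda>t. (cmod (expsum F c t))\<^sup>2)"
proof -
  have "cmod (expsum F c t) \<le> (\<Sum>\<mu>\<in>F. cmod (c \<mu>))" for t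
    unfolding expsum_def by (rule sum_norm_le) (simp add: norm_mult)
  then show L2: "L2_on {0<..<T} (expsum F c)"
    by (intro L2_on_bounded continuous_imp_measurable_on_sets_lebesgue continuous_intros) auto
  show "(LINT t|lebesgue_on {0<..<T}. (cmod (expsum F c t))\<^sup>2) = integral {0..T} (\<lambda>t. (cmod (expsum F c t))\<^sup>2)"
    using L2 by (subst lebesgue_integral_eq_integral) (auto simp: L2_on_def integral_open_interval_real)
qed

text \<open>Ingham's inequality applies to the partial sum, a finite exponential sum, and not to f
  itself; the distance between the two is kept as an error term that vanishes as N grows. The
  constant depends on p, v and T only, not on N, the base point or the gauge.\<close>

lemma class_energy_le_line_restriction:
  assumes "2 < degree p" "0 < T"
  obtains C where "0 < C" "\<And>u0 u t0 x0 f A B N. is_solution p u0 u \<Longrightarrow> is_line_restriction u t0 x0 v T f \<Longrightarrow>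
    A * v + B = x0 + v * t0 \<Longrightarrow>
    class_energy p v {- int N..int N} (\<lambda>k. fourier_coeff u0 k * cis (A * poly p (of_int k) + B * of_int k)) \<le>
    C * ((LINT t|lebesgue_on {0<..<T}. (cmod (f t))\<^sup>2) +
      (LINT t|lebesgue_on {0<..<T}. (cmod (f t - fourier_partial_sum N (u (t0 + t)) (x0 - v * t)))\<^sup>2))"
proof -
  obtain C where C: "0 < C" "\<And>F c. finite F \<Longrightarrow> F \<subseteq> range (lam p v) \<Longrightarrow>
     (\<Sum>\<mu>\<in>F. (cmod (c \<mu>))\<^sup>2) \<le> C * integral {0..T} (\<lambda>t. (cmod (expsum F c t))\<^sup>2)"
    using ingham_lower_lam[OF assms, of v] unfolding ingham_lower_def by blast
  have "class_energy p v {- int N..int N} (\<lambda>k. fourier_coeff u0 k * cis (A * poly p (of_int k) + B * of_int k)) \<le>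
    (2 * C) * ((LINT t|lebesgue_on {0<..<T}. (cmod (f t))\<^sup>2) +
      (LINT t|lebesgue_on {0<..<T}. (cmod (f t - fourier_partial_sum N (u (t0 + t)) (x0 - v * t)))\<^sup>2))"
    if sol: "is_solution p u0 u" and f: "is_line_restriction u t0 x0 v T f" and gauge: "A * v + B = x0 + v * t0"
    for u0 u t0 x0 f A B N
  proof -
    define K where "K = {- int N..int N}"
    define d where "d k = fourier_coeff u0 k * cis (A * poly p (of_int k) + B * of_int k)" for k
    define s where "s \<mu> = cis ((t0 - A) * \<mu>) * (\<Sum>k | k \<in> K \<and> lam p v k = \<mu>. d k)" for \<mu>
    define g where "g = expsum (lam p v ` K) s"
    have g: "fourier_partial_sum N (u (t0 + t)) (x0 - v * t) = g t" for t
      unfolding g_def s_def d_def K_def by (rule fourier_partial_sum_expsum[OF sol gauge])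
    have L2f: "L2_on {0<..<T} f" using f by (simp add: is_line_restriction_def)
    have L2g: "L2_on {0<..<T} g" unfolding g_def by (rule L2_on_expsum)
    have "class_energy p v K d = (\<Sum>\<mu>\<in>lam p v ` K. (cmod (s \<mu>))\<^sup>2)"
      by (simp add: class_energy_def s_def norm_mult)
    also have "\<dots> \<le> C * (LINT t|lebesgue_on {0<..<T}. (cmod (g t))\<^sup>2)"
      unfolding g_def L2_on_expsum(2) by (rule C(2)) (auto simp: K_def)
    also have "(LINT t|lebesgue_on {0<..<T}. (cmod (g t))\<^sup>2) \<le>
        2 * (LINT t|lebesgue_on {0<..<T}. (cmod (f t))\<^sup>2) + 2 * (LINT t|lebesgue_on {0<..<T}. (cmod (f t - g t))\<^sup>2)"
      using L2_on_add(2)[OF L2f L2_on_uminus[OF L2_on_diff[OF L2f L2g]]] by (simp add: norm_minus_commute)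
    finally show ?thesis
      using C(1) unfolding g K_def[symmetric] d_def[symmetric] by (simp add: algebra_simps)
  qed
  then show ?thesis using that[of "2 * C"] C(1) by simp
qed

lemma gauge_exists:
  fixes v1 v2 a1 a2 :: real
  assumes "v1 \<noteq> v2"
  obtains A B where "A * v1 + B = a1" "A * v2 + B = a2"
proof
  define A where "A = (a1 - a2) / (v1 - v2)"
  have "A * (v1 - v2) = a1 - a2" using assms by (simp add: A_def)
  then show "A * v1 + (a1 - A * v1) = a1" "A * v2 + (a1 - A * v1) = a2"
    by (simp_all add: algebra_simps)
qed

lemma acyclic_imp_quantitative:
  assumes deg: "2 < degree p" and T: "0 < T" and v: "v1 \<noteq> v2" and nc: "\<not> has_two_colored_cycle p v1 v2"
  shows "quantitative_observability p T t1 x1 v1 t2 x2 v2"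
proof -
  obtain A B where gauge: "A * v1 + B = x1 + v1 * t1" "A * v2 + B = x2 + v2 * t2"
    using gauge_exists[OF v] by blast
  obtain C0 where C0: "0 < C0" "\<And>K d. finite K \<Longrightarrow>
    (\<Sum>k\<in>K. (cmod (d k))\<^sup>2) \<le> C0 * (class_energy p v1 K d + class_energy p v2 K d)"
    using energy_le_class_energies[OF deg v nc] by blast
  obtain C1 where C1: "0 < C1" "\<And>u0 u t0 x0 f A B N. is_solution p u0 u \<Longrightarrow> is_line_restriction u t0 x0 v1 T f \<Longrightarrow>
    A * v1 + B = x0 + v1 * t0 \<Longrightarrow>
    class_energy p v1 {- int N..int N} (\<lambda>k. fourier_coeff u0 k * cis (A * poly p (of_int k) + B * of_int k)) \<le>
    C1 * ((LINT t|lebesgue_on {0<..<T}. (cmod (f t))\<^sup>2) +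
      (LINT t|lebesgue_on {0<..<T}. (cmod (f t - fourier_partial_sum N (u (t0 + t)) (x0 - v1 * t)))\<^sup>2))"
    using class_energy_le_line_restriction[OF deg T, of v1] by blast
  obtain C2 where C2: "0 < C2" "\<And>u0 u t0 x0 f A B N. is_solution p u0 u \<Longrightarrow> is_line_restriction u t0 x0 v2 T f \<Longrightarrow>
    A * v2 + B = x0 + v2 * t0 \<Longrightarrow>
    class_energy p v2 {- int N..int N} (\<lambda>k. fourier_coeff u0 k * cis (A * poly p (of_int k) + B * of_int k)) \<le>
    C2 * ((LINT t|lebesgue_on {0<..<T}. (cmod (f t))\<^sup>2) +
      (LINT t|lebesgue_on {0<..<T}. (cmod (f t - fourier_partial_sum N (u (t0 + t)) (x0 - v2 * t)))\<^sup>2))"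
    using class_energy_le_line_restriction[OF deg T, of v2] by blast
  define D where "D = max C1 C2"
  have D: "0 < D" "C1 \<le> D" "C2 \<le> D" using C1(1) by (auto simp: D_def)
  show ?thesis
    unfolding quantitative_observability_def
  proof (intro exI[of _ "2 * pi * (C0 * D)"] conjI allI impI)
    show "0 < 2 * pi * (C0 * D)" using C0(1) D(1) by simp
    fix u0 u f1 f2
    assume sol: "is_solution p u0 u" and f1: "is_line_restriction u t1 x1 v1 T f1"
      and f2: "is_line_restriction u t2 x2 v2 T f2"
    let ?M = "lebesgue_on {0<..<T}"
    define F1 where "F1 = (LINT t|?M. (cmod (f1 t))\<^sup>2)"
    define F2 where "F2 = (LINT t|?M. (cmod (f2 t))\<^sup>2)"
    define e1 where "e1 N = (LINT t|?M. (cmod (f1 t - fourier_partial_sum N (u (t1 + t)) (x1 - v1 * t)))\<^sup>2)" for N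
    define e2 where "e2 N = (LINT t|?M. (cmod (f2 t - fourier_partial_sum N (u (t2 + t)) (x2 - v2 * t)))\<^sup>2)" for N
    have e: "e1 \<longlonglongrightarrow> 0" "e2 \<longlonglongrightarrow> 0"
      using f1 f2 by (simp_all add: is_line_restriction_def e1_def[abs_def] e2_def[abs_def])
    have F0: "0 \<le> F1" "0 \<le> F2" "0 \<le> e1 N" "0 \<le> e2 N" for N
      by (simp_all add: F1_def F2_def e1_def e2_def)
    have fin: "(\<Sum>k\<in>{- int N..int N}. (cmod (fourier_coeff u0 k))\<^sup>2) \<le> C0 * (D * (F1 + e1 N) + D * (F2 + e2 N))" for N
    proof -
      define d where "d k = fourier_coeff u0 k * cis (A * poly p (of_int k) + B * of_int k)" for k
      let ?K = "{- int N..int N}"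
      \<comment> \<open>The gauge factors have modulus 1, so the same \<open>d\<close> can be used
        for both lines without changing the energy.\<close>
      have "(\<Sum>k\<in>?K. (cmod (fourier_coeff u0 k))\<^sup>2) = (\<Sum>k\<in>?K. (cmod (d k))\<^sup>2)"
        by (simp add: d_def norm_mult)
      also have "\<dots> \<le> C0 * (class_energy p v1 ?K d + class_energy p v2 ?K d)"
        by (rule C0(2)) simp
      also have "\<dots> \<le> C0 * (D * (F1 + e1 N) + D * (F2 + e2 N))"
      proof (intro mult_left_mono add_mono)
        have "class_energy p v1 ?K d \<le> C1 * (F1 + e1 N)"
          unfolding d_def F1_def e1_def using sol f1 gauge(1) by (rule C1(2))
        also have "\<dots> \<le> D * (F1 + e1 N)" using D F0 by (intro mult_right_mono) auto
        finally show "class_energy p v1 ?K d \<le> D * (F1 + e1 N)" .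
        have "class_energy p v2 ?K d \<le> C2 * (F2 + e2 N)"
          unfolding d_def F2_def e2_def using sol f2 gauge(2) by (rule C2(2))
        also have "\<dots> \<le> D * (F2 + e2 N)" using D F0 by (intro mult_right_mono) auto
        finally show "class_energy p v2 ?K d \<le> D * (F2 + e2 N)" .
      qed (use C0(1) in simp)
      finally show ?thesis .
    qed
    have lim: "(\<lambda>N. C0 * (D * (F1 + e1 N) + D * (F2 + e2 N))) \<longlonglongrightarrow> C0 * (D * (F1 + 0) + D * (F2 + 0))"
      by (intro tendsto_intros e)
    \<comment> \<open>The left side increases with N; it is therefore bounded by the right side at
      every n >= N, and n tends to infinity with N fixed.\<close>
    have "(\<Sum>k\<in>{- int N..int N}. (cmod (fourier_coeff u0 k))\<^sup>2) \<le> C0 * (D * (F1 + 0) + D * (F2 + 0))" for N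
    proof (rule LIMSEQ_le_const[OF lim], intro exI allI impI)
      fix n assume "N \<le> n"
      then have "(\<Sum>k\<in>{- int N..int N}. (cmod (fourier_coeff u0 k))\<^sup>2) \<le> (\<Sum>k\<in>{- int n..int n}. (cmod (fourier_coeff u0 k))\<^sup>2)"
        by (intro sum_mono2) auto
      then show "(\<Sum>k\<in>{- int N..int N}. (cmod (fourier_coeff u0 k))\<^sup>2) \<le> C0 * (D * (F1 + e1 n) + D * (F2 + e2 n))"
        using fin[of n] by linarith
    qed
    then have "(LINT x|lebesgue_on {0..2 * pi}. (cmod (u0 x))\<^sup>2) \<le> 2 * pi * (C0 * (D * (F1 + 0) + D * (F2 + 0)))"
      using sol by (intro L2_le_fourier_bound) (auto simp: is_solution_def L2_torus_def)
    also have "\<dots> = 2 * pi * (C0 * D) * (F1 + F2)" by (simp add: algebra_simps)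
    also have "F1 + F2 = (LINT t|?M. (cmod (f1 t))\<^sup>2 + (cmod (f2 t))\<^sup>2)"
      unfolding F1_def F2_def using f1 f2
      by (subst Bochner_Integration.integral_add) (auto simp: is_line_restriction_def L2_on_def)
    finally show "(LINT x|lebesgue_on {0..2 * pi}. (cmod (u0 x))\<^sup>2) \<le>
      2 * pi * (C0 * D) * (LINT t|?M. (cmod (f1 t))\<^sup>2 + (cmod (f2 t))\<^sup>2)" .
  qed
qed

lemma quantitative_imp_qualitative:
  assumes "quantitative_observability p T t1 x1 v1 t2 x2 v2"
  shows "qualitative_observability p T t1 x1 v1 t2 x2 v2"
  unfolding qualitative_observability_def
proof (intro allI impI)
  fix u0 u f1 f2
  assume sol: "is_solution p u0 u" and f1: "is_line_restriction u t1 x1 v1 T f1"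
    and f2: "is_line_restriction u t2 x2 v2 T f2"
    and zero: "AE t in lebesgue_on {0<..<T}. f1 t = 0" "AE t in lebesgue_on {0<..<T}. f2 t = 0"
  obtain C where C: "(LINT x|lebesgue_on {0..2 * pi}. (cmod (u0 x))\<^sup>2) \<le>
      C * (LINT t|lebesgue_on {0<..<T}. (cmod (f1 t))\<^sup>2 + (cmod (f2 t))\<^sup>2)"
    using assms sol f1 f2 unfolding quantitative_observability_def by blast
  have "AE t in lebesgue_on {0<..<T}. (cmod (f1 t))\<^sup>2 + (cmod (f2 t))\<^sup>2 = 0"
    using zero by eventually_elim simp
  then have "(LINT t|lebesgue_on {0<..<T}. (cmod (f1 t))\<^sup>2 + (cmod (f2 t))\<^sup>2) = 0"
    by (rule integral_eq_zero_AE)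
  with C have "(LINT x|lebesgue_on {0..2 * pi}. (cmod (u0 x))\<^sup>2) \<le> 0" by simp
  then have "(LINT x|lebesgue_on {0..2 * pi}. (cmod (u0 x))\<^sup>2) = 0"
    by (intro antisym) auto
  moreover have "integrable (lebesgue_on {0..2 * pi}) (\<lambda>x. (cmod (u0 x))\<^sup>2)"
    using sol by (simp add: is_solution_def L2_torus_def L2_on_def)
  ultimately have "AE x in lebesgue_on {0..2 * pi}. (cmod (u0 x))\<^sup>2 = 0"
    by (subst (asm) integral_nonneg_eq_0_iff_AE) auto
  then show "AE x in lebesgue_on {0..2 * pi}. u0 x = 0"
    by eventually_elim simp
qed

section \<open>Nonzero solutions that vanish on both lines\<close>

lemma L2_torus_trig_sum:
  assumes "finite K"
  shows "L2_torus (\<lambda>x. \<Sum>k\<in>K. b k * cis (of_int k * x))"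
proof -
  have "cis (of_int k * (x + 2 * pi)) = cis (of_int k * x)" for k :: int and x
  proof -
    have "cis (of_int k * (x + 2 * pi)) = cis (of_int k * x) * cis (2 * pi * of_int k)"
      by (simp add: cis_mult algebra_simps)
    then show ?thesis by (simp add: cis_multiple_2pi)
  qed
  then show ?thesis
    unfolding L2_torus_def by (auto intro!: L2_on_continuous continuous_intros)
qed

lemma trig_sum_solution:
  assumes "finite K"
  shows "is_solution p (\<lambda>x. \<Sum>k\<in>K. b k * cis (of_int k * x))
    (\<lambda>t x. \<Sum>k\<in>K. (b k * cis (poly p (of_int k) * t)) * cis (of_int k * x))"
  unfolding is_solution_def
proof (intro conjI allI L2_torus_trig_sum assms)
  fix k t
  let ?a = "poly p (of_int k)"
  have "((\<lambda>z. b k * exp (\<i> * (of_real ?a * z))) has_field_derivative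
      \<i> * (of_real ?a * (b k * exp (\<i> * (of_real ?a * of_real t))))) (at (of_real t))"
    by (auto intro!: derivative_eq_intros)
  from has_vector_derivative_real_field[OF this]
  have "((\<lambda>s. b k * cis (?a * s)) has_vector_derivative \<i> * (of_real ?a * (b k * cis (?a * t)))) (at t)"
    by (simp add: cis_conv_exp)
  then show "((\<lambda>s. fourier_coeff (\<lambda>x. \<Sum>k\<in>K. (b k * cis (poly p (of_int k) * s)) * cis (of_int k * x)) k) has_vector_derivative
      \<i> * (of_real ?a * fourier_coeff (\<lambda>x. \<Sum>k\<in>K. (b k * cis (poly p (of_int k) * t)) * cis (of_int k * x)) k)) (at t)"
    unfolding fourier_coeff_trig_sum[OF assms] by simp
qed simp

lemma qualitative_imp_acyclic:
  assumes v: "v1 \<noteq> v2" and qual: "qualitative_observability p T t1 x1 v1 t2 x2 v2"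
  shows "\<not> has_two_colored_cycle p v1 v2"
proof
  assume "has_two_colored_cycle p v1 v2"
  from kernel_of_two_colored_cycle[OF v this]
  obtain K d where K: "finite K" and d0: "\<And>k. k \<notin> K \<Longrightarrow> d k = 0" and dne: "\<exists>k. d k \<noteq> (0::real)"
    and ker: "\<And>v \<mu>. v \<in> {v1, v2} \<Longrightarrow> (\<Sum>k | k \<in> K \<and> lam p v k = \<mu>. d k) = 0"
    by blast
  obtain A B where gauge: "A * v1 + B = x1 + v1 * t1" "A * v2 + B = x2 + v2 * t2"
    using gauge_exists[OF v] by blast
  \<comment> \<open>The inverse gauge factor is built into the datum, so that the gauged
    coefficients on either line are exactly d and all class sums vanish.\<close>
  define b where "b k = of_real (d k) * cis (- (A * poly p (of_int k) + B * of_int k))" for k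
  define u0 where "u0 = (\<lambda>x. \<Sum>k\<in>K. b k * cis (of_int k * x))"
  define u where "u = (\<lambda>t x. \<Sum>k\<in>K. (b k * cis (poly p (of_int k) * t)) * cis (of_int k * x))"
  have sol: "is_solution p u0 u" unfolding u0_def u_def by (rule trig_sum_solution[OF K])
  have coeff: "fourier_coeff u0 k = b k" for k
    unfolding u0_def fourier_coeff_trig_sum[OF K] using d0 by (simp add: b_def)
  have gauged: "fourier_coeff u0 k * cis (A * poly p (of_int k) + B * of_int k) = of_real (d k)" for k
    by (simp add: coeff b_def mult.assoc cis_mult)
  obtain N0 where K_sub: "\<And>N. N0 \<le> N \<Longrightarrow> K \<subseteq> {- int N..int N}"
    using finite_int_subset_symmetric[OF K] by auto
  have restr: "is_line_restriction u t0 x0 v T (\<lambda>t. 0)"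
    if v: "v \<in> {v1, v2}" and g: "A * v + B = x0 + v * t0" for v t0 x0
  proof -
    \<comment> \<open>Once the summation range contains K, whole classes of K are summed and the
      partial sums vanish identically; smaller N may cut a class apart, hence the threshold
      \<open>N0\<close>.\<close>
    have zero: "fourier_partial_sum N (u (t0 + t)) (x0 - v * t) = 0" if "N0 \<le> N" for N t
    proof -
      have "(\<Sum>k | k \<in> {- int N..int N} \<and> lam p v k = \<mu>. complex_of_real (d k)) =
          (\<Sum>k | k \<in> K \<and> lam p v k = \<mu>. complex_of_real (d k))" for \<mu>
        using K_sub[OF that] d0 by (intro sum.mono_neutral_right) (auto intro: finite_subset[of _ "{- int N..int N}"])
      also have "\<dots> \<mu> = of_real (\<Sum>k | k \<in> K \<and> lam p v k = \<mu>. d k)" for \<mu> by simp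
      finally show ?thesis
        unfolding fourier_partial_sum_expsum[OF sol g] gauged using ker[OF v]
        by (simp add: expsum_def)
    qed
    have "L2_on {0<..<T} (\<lambda>t. 0)" by (simp add: L2_on_def)
    moreover have "\<forall>\<^sub>F N in sequentially. (LINT t|lebesgue_on {0<..<T}.
        (cmod (0 - fourier_partial_sum N (u (t0 + t)) (x0 - v * t)))\<^sup>2) = 0"
      using eventually_ge_at_top[of N0] by eventually_elim (simp add: zero)
    ultimately show ?thesis
      unfolding is_line_restriction_def by (auto intro: tendsto_eventually)
  qed
  have "AE x in lebesgue_on {0..2 * pi}. u0 x = 0"
    using qual sol restr[OF _ gauge(1)] restr[OF _ gauge(2)]
    unfolding qualitative_observability_def by auto
  then have "fourier_coeff u0 k = fourier_coeff (\<lambda>x. 0) k" for k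
    using sol by (intro fourier_coeff_cong_AE) (auto simp: is_solution_def L2_torus_def L2_on_def)
  moreover have "fourier_coeff (\<lambda>x. 0) k = 0" for k
    by (simp add: fourier_coeff_def)
  ultimately have "b k = 0" for k
    by (simp add: coeff)
  then have "d k = 0" for k
    by (simp add: b_def)
  with dne show False by blast
qed

theorem theorem1p7:
  fixes p :: "real poly" and T t1 x1 t2 x2 v1 v2 :: real
  assumes "degree p > 2"
    and "T > 0"
    and "v1 \<noteq> v2"
  shows "(qualitative_observability p T t1 x1 v1 t2 x2 v2 \<longleftrightarrow>
            quantitative_observability p T t1 x1 v1 t2 x2 v2)
       \<and> (quantitative_observability p T t1 x1 v1 t2 x2 v2 \<longleftrightarrow>
            \<not> has_two_colored_cycle p v1 v2)"
  using acyclic_imp_quantitative[OF assms] quantitative_imp_qualitative qualitative_imp_acyclic[OF assms(3)]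
  by blast

end
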